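(* (Relations for $\mathcal K_{n,m}$.) Let $\mathcal L$ be a positive definite linear functional on $\prod^{N,M}$. For $0<n\le N$, $0<m\le M$, $$\Gamma^1_{n,m-1}\mathcal K_{n,m}=\mathcal K_{n,m-1}(\tilde A_{n-1,m}^{-1})^\dagger-\mathcal K^1_{n,m-1}\hat{\tilde E}_{n-1,m}^\dagger(\tilde A_{n-1,m}^{-1})^\dagger,$$ $$\mathcal K_{n,m}(\tilde\Gamma^1_{n-1,m})^\dagger=A_{n,m-1}^{-1}\mathcal K_{n-1,m}-A_{n,m-1}^{-1}\hat E_{n,m-1}\overline{\mathcal K^1_{n-1,m}}.$$
   Context: $\prod^{N,M}=\mathrm{span}\{z^iw^j:|i|\le N,|j|\le M\}$, $\hat\prod^{N,M}=\mathrm{span}\{z^iw^j:0\le i\le N,0\le j\le M\}$. For a (matrix valued) Laurent polynomial $Q$, $Q^\dagger(z,w)=Q(1/\bar z,1/\bar w)^\dagger$. A linear functional $\mathcal L$ on $\prod^{N,M}$ with $\mathcal L(z^{-i}w^{-j})=\overline{\mathcal L(z^iw^j)}$ is positive definite if $\mathcal L(pp^\dagger)>0$ for all nonzero $p\in\hat\prod^{N,M}$. It is applied entrywise and, for column vectors, $\langle X,Y\rangle=\mathcal L(XY^\dagger)$. Bars on matrices are entrywise conjugates. For $0\le l\le m$, $\phi^l_{n,m}$ is the unique element of $\mathrm{span}(\{z^iw^j:0\le i<n,0\le j\le m\}\cup\{z^nw^j:0\le j\le l\})$ with positive coefficient of $z^nw^l$, $\langle\phi^l_{n,m},\phi^l_{n,m}\rangle=1$,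 orthogonal to all of these monomials except $z^nw^l$; $\Phi_{n,m}=[\phi^m_{n,m},\dots,\phi^0_{n,m}]^T$. For $0\le l\le n$, $\tilde\phi^l_{n,m}$ is the unique element of $\mathrm{span}(\{z^iw^j:0\le i\le n,0\le j<m\}\cup\{z^iw^m:0\le i\le l\})$ with positive coefficient of $z^lw^m$, norm one, orthogonal to all of these monomials except $z^lw^m$; $\tilde\Phi_{n,m}=[\tilde\phi^n_{n,m},\dots,\tilde\phi^0_{n,m}]^T$. Reversals are the row vectors $\overleftarrow\Phi_{n,m}(z,w)=z^nw^m\Phi_{n,m}(1/\bar z,1/\bar w)^\dagger$, $\overleftarrow{\tilde\Phi}_{n,m}(z,w)=z^nw^m\tilde\Phi_{n,m}(1/\bar z,1/\bar w)^\dagger$. $\Phi_{n,-1}$ and $\tilde\Phi_{-1,m}$ are empty; matrices with zero rows or columns are empty. Coefficients: $\hat E_{n,m}=\langle z\Phi_{n-1,m},\overleftarrow\Phi_{n-1,m}^T\rangle$, $A_{n,m}=\langle z\Phi_{n-1,m},\Phi_{n,m}\rangle$ ($n\ge1$; $A_{n,m}$ is invertible), $\hat{\tilde E}_{n,m}=\langle w\tilde\Phi_{n,m-1},\overleftarrow{\tilde\Phi}_{n,m-1}^T\rangle$, $\tilde A_{n,m}=\langle w\tilde\Phi_{n,m-1},\tilde\Phi_{n,m}\rangle$ ($m\ge1$; $\tilde A_{n,m}$ is invertible), $\mathcal K_{n,m}=\langle\Phi_{n,m-1},\tilde\Phi_{n-1,m}\rangle$, $\mathcal K^1_{n,m}=\langle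 w\Phi_{n,m-1},\overleftarrow{\tilde\Phi}_{n-1,m}^T\rangle$, $\Gamma^1_{n,m}=\langle w\Phi_{n,m-1},\Phi_{n,m}\rangle$, $\tilde\Gamma^1_{n,m}=\langle z\tilde\Phi_{n-1,m},\tilde\Phi_{n,m}\rangle$. *)

theory Defs
  imports
    "HOL-Library.Poly_Mapping"
    "HOL-Library.Product_Plus"
    "Jordan_Normal_Form.Gauss_Jordan_Elimination"
    "Jordan_Normal_Form.Schur_Decomposition"
begin

text \<open>The coefficient of \<open>z^i w^j\<close> in \<open>p\<close> is \<open>Poly_Mapping.lookup p (i, j)\<close>; the product of
  \<open>poly_mapping\<close> is convolution, i.e. the product of Laurent polynomials.\<close>

type_synonym laurent = "(int \<times> int) \<Rightarrow>\<^sub>0 complex"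

definition zw_monom :: "int \<Rightarrow> int \<Rightarrow> laurent" where
  "zw_monom i j = Poly_Mapping.single (i, j) 1"

definition lscale :: "complex \<Rightarrow> laurent \<Rightarrow> laurent" where
  "lscale c p = Poly_Mapping.single 0 c * p"

lemma lookup_lscale [simp]: "Poly_Mapping.lookup (lscale c p) k = c * Poly_Mapping.lookup p k"
  by (simp add: lscale_def Poly_Mapping.map.rep_eq when_def flip: mult_map_scale_conv_mult)

interpretation laurent: vector_space lscale
  by unfold_locales
    (simp_all add: poly_mapping_eq_iff fun_eq_iff lookup_add algebra_simps)

text \<open>As a function, \<open>ldagger p\<close> is the conjugate of \<open>p(1/cnj z, 1/cnj w)\<close>; see \<open>leval_ldagger\<close>.\<close>

definition ldagger :: "laurent \<Rightarrow> laurent" where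
  "ldagger p = (\<Sum>k\<in>Poly_Mapping.keys p. Poly_Mapping.single (- k) (cnj (Poly_Mapping.lookup p k)))"

definition leval :: "laurent \<Rightarrow> complex \<Rightarrow> complex \<Rightarrow> complex" where
  "leval p z w = (\<Sum>k\<in>Poly_Mapping.keys p. Poly_Mapping.lookup p k * z powi fst k * w powi snd k)"

lemma lookup_ldagger: "Poly_Mapping.lookup (ldagger p) k = cnj (Poly_Mapping.lookup p (- k))"
proof -
  have "Poly_Mapping.lookup (ldagger p) k =
      (\<Sum>l\<in>Poly_Mapping.keys p. if l = - k then cnj (Poly_Mapping.lookup p l) else 0)"
    unfolding ldagger_def lookup_sum
    by (rule sum.cong) (auto simp: lookup_single when_def)
  also have "\<dots> = cnj (Poly_Mapping.lookup p (- k))"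
    by (auto simp: sum.delta in_keys_iff)
  finally show ?thesis .
qed

lemma leval_ldagger:
  "leval (ldagger p) z w = cnj (leval p (1 / cnj z) (1 / cnj w))"
proof -
  have keys: "Poly_Mapping.keys (ldagger p) = uminus ` Poly_Mapping.keys p"
  proof (intro equalityI subsetI)
    fix k assume "k \<in> Poly_Mapping.keys (ldagger p)"
    then have "- k \<in> Poly_Mapping.keys p"
      by (simp add: in_keys_iff lookup_ldagger)
    then show "k \<in> uminus ` Poly_Mapping.keys p"
      by (intro image_eqI[of _ _ "- k"]) simp_all
  qed (auto simp: in_keys_iff lookup_ldagger)
  have cnj_powi: "cnj ((1 / cnj u) powi i) = u powi (- i)" for u i
    by (auto simp: power_int_def power_inverse divide_inverse)
  show ?thesis
    unfolding leval_def keys cnj_sum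
    by (subst sum.reindex)
      (simp_all add: inj_on_def lookup_ldagger cnj_powi[simplified])
qed

definition Pi_space :: "int \<Rightarrow> int \<Rightarrow> laurent set" where
  "Pi_space N M = laurent.span {zw_monom i j | i j. \<bar>i\<bar> \<le> N \<and> \<bar>j\<bar> \<le> M}"

definition Pi_hat :: "int \<Rightarrow> int \<Rightarrow> laurent set" where
  "Pi_hat N M = laurent.span {zw_monom i j | i j. 0 \<le> i \<and> i \<le> N \<and> 0 \<le> j \<and> j \<le> M}"

text \<open>A functional on a subspace \<open>V\<close> is a function on all Laurent polynomials of which only the
  values on \<open>V\<close> matter.\<close>

definition linear_functional_on :: "laurent set \<Rightarrow> (laurent \<Rightarrow> complex) \<Rightarrow> bool" where
  "linear_functional_on V L \<longleftrightarrow>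
     (\<forall>p\<in>V. \<forall>q\<in>V. L (p + q) = L p + L q) \<and> (\<forall>c. \<forall>p\<in>V. L (lscale c p) = c * L p)"

definition positive_real :: "complex \<Rightarrow> bool" where
  "positive_real c \<longleftrightarrow> c \<in> \<real> \<and> 0 < Re c"

definition pos_def_functional :: "int \<Rightarrow> int \<Rightarrow> (laurent \<Rightarrow> complex) \<Rightarrow> bool" where
  "pos_def_functional N M L \<longleftrightarrow>
     linear_functional_on (Pi_space N M) L \<and>
     (\<forall>i j. \<bar>i\<bar> \<le> N \<and> \<bar>j\<bar> \<le> M \<longrightarrow> L (zw_monom (- i) (- j)) = cnj (L (zw_monom i j))) \<and>
     (\<forall>p\<in>Pi_hat N M. p \<noteq> 0 \<longrightarrow> positive_real (L (p * ldagger p)))"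

text \<open>Matrix valued Laurent polynomials are matrices of Laurent polynomials; vectors of
  polynomials are matrices with one column or one row.\<close>

definition mdagger :: "laurent mat \<Rightarrow> laurent mat" where
  "mdagger Q = map_mat ldagger (transpose_mat Q)"

definition minner :: "(laurent \<Rightarrow> complex) \<Rightarrow> laurent mat \<Rightarrow> laurent mat \<Rightarrow> complex mat" where
  "minner L X Y = map_mat L (X * mdagger Y)"

definition sinner :: "(laurent \<Rightarrow> complex) \<Rightarrow> laurent \<Rightarrow> laurent \<Rightarrow> complex" where
  "sinner L p q = L (p * ldagger q)"

definition orthonormal_for ::
  "(laurent \<Rightarrow> complex) \<Rightarrow> (int \<times> int) set \<Rightarrow> int \<times> int \<Rightarrow> laurent \<Rightarrow> bool" where
  "orthonormal_for L S k p \<longleftrightarrow>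
     p \<in> laurent.span {zw_monom i j | i j. (i, j) \<in> S} \<and>
     positive_real (Poly_Mapping.lookup p k) \<and>
     sinner L p p = 1 \<and>
     (\<forall>(i, j)\<in>S - {k}. sinner L p (zw_monom i j) = 0)"

text \<open>In \<open>phi L l n m\<close> and \<open>phit L l n m\<close> the first index is the superscript. All indices are
  integers because the index -1 occurs.\<close>

definition phi :: "(laurent \<Rightarrow> complex) \<Rightarrow> int \<Rightarrow> int \<Rightarrow> int \<Rightarrow> laurent" where
  "phi L l n m =
     (THE p. orthonormal_for L ({0..<n} \<times> {0..m} \<union> {n} \<times> {0..l}) (n, l) p)"

definition phit :: "(laurent \<Rightarrow> complex) \<Rightarrow> int \<Rightarrow> int \<Rightarrow> int \<Rightarrow> laurent" where
  "phit L l n m =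
     (THE p. orthonormal_for L ({0..n} \<times> {0..<m} \<union> {0..l} \<times> {m}) (l, m) p)"

text \<open>Columns with \<open>m + 1\<close> resp. \<open>n + 1\<close> entries, the superscript decreasing to 0; \<open>Phi L n (- 1)\<close>
  and \<open>Phit L (- 1) m\<close> have no rows.\<close>

definition Phi :: "(laurent \<Rightarrow> complex) \<Rightarrow> int \<Rightarrow> int \<Rightarrow> laurent mat" where
  "Phi L n m = mat (nat (m + 1)) 1 (\<lambda>(r, _). phi L (m - int r) n m)"

definition Phit :: "(laurent \<Rightarrow> complex) \<Rightarrow> int \<Rightarrow> int \<Rightarrow> laurent mat" where
  "Phit L n m = mat (nat (n + 1)) 1 (\<lambda>(r, _). phit L (n - int r) n m)"

definition rev_Phi :: "(laurent \<Rightarrow> complex) \<Rightarrow> int \<Rightarrow> int \<Rightarrow> laurent mat" where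
  "rev_Phi L n m = zw_monom n m \<cdot>\<^sub>m mdagger (Phi L n m)"

definition rev_Phit :: "(laurent \<Rightarrow> complex) \<Rightarrow> int \<Rightarrow> int \<Rightarrow> laurent mat" where
  "rev_Phit L n m = zw_monom n m \<cdot>\<^sub>m mdagger (Phit L n m)"

definition E_hat :: "(laurent \<Rightarrow> complex) \<Rightarrow> int \<Rightarrow> int \<Rightarrow> complex mat" where
  "E_hat L n m = minner L (zw_monom 1 0 \<cdot>\<^sub>m Phi L (n - 1) m) (transpose_mat (rev_Phi L (n - 1) m))"

definition A_coeff :: "(laurent \<Rightarrow> complex) \<Rightarrow> int \<Rightarrow> int \<Rightarrow> complex mat" where
  "A_coeff L n m = minner L (zw_monom 1 0 \<cdot>\<^sub>m Phi L (n - 1) m) (Phi L n m)"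

definition Et_hat :: "(laurent \<Rightarrow> complex) \<Rightarrow> int \<Rightarrow> int \<Rightarrow> complex mat" where
  "Et_hat L n m = minner L (zw_monom 0 1 \<cdot>\<^sub>m Phit L n (m - 1)) (transpose_mat (rev_Phit L n (m - 1)))"

definition At_coeff :: "(laurent \<Rightarrow> complex) \<Rightarrow> int \<Rightarrow> int \<Rightarrow> complex mat" where
  "At_coeff L n m = minner L (zw_monom 0 1 \<cdot>\<^sub>m Phit L n (m - 1)) (Phit L n m)"

definition K_coeff :: "(laurent \<Rightarrow> complex) \<Rightarrow> int \<Rightarrow> int \<Rightarrow> complex mat" where
  "K_coeff L n m = minner L (Phi L n (m - 1)) (Phit L (n - 1) m)"

definition K1_coeff :: "(laurent \<Rightarrow> complex) \<Rightarrow> int \<Rightarrow> int \<Rightarrow> complex mat" where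
  "K1_coeff L n m =
     minner L (zw_monom 0 1 \<cdot>\<^sub>m Phi L n (m - 1)) (transpose_mat (rev_Phit L (n - 1) m))"

definition Gamma1 :: "(laurent \<Rightarrow> complex) \<Rightarrow> int \<Rightarrow> int \<Rightarrow> complex mat" where
  "Gamma1 L n m = minner L (zw_monom 0 1 \<cdot>\<^sub>m Phi L n (m - 1)) (Phi L n m)"

definition Gammat1 :: "(laurent \<Rightarrow> complex) \<Rightarrow> int \<Rightarrow> int \<Rightarrow> complex mat" where
  "Gammat1 L n m = minner L (zw_monom 1 0 \<cdot>\<^sub>m Phit L (n - 1) m) (Phit L n m)"

text \<open>The two-sided inverse when it exists; unspecified otherwise.\<close>

definition minv :: "complex mat \<Rightarrow> complex mat" where
  "minv A = the (mat_inverse A)"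

end

theory Submission
  imports Defs
begin

text \<open>Exchanging the two variables turns \<open>\<Phi>\<close> into the tilde family, so both are treated as one
  family depending on an additive injection \<open>\<sigma>\<close> of the exponent lattice (\<open>id\<close> or the swap). The
  recurrence \<open>z \<Phi>\<^sub>n\<^sub>-\<^sub>1 = A \<Phi>\<^sub>n + E rev \<Phi>\<^sub>n\<^sub>-\<^sub>1\<close> holds because the difference \<open>z \<Phi>\<^sub>n\<^sub>-\<^sub>1 - A \<Phi>\<^sub>n\<close> has
  \<open>z\<close>-degree below \<open>n\<close> and is orthogonal to all \<open>z\<^sup>i w\<^sup>j\<close> with \<open>1 \<le> i < n\<close>, which characterises the span
  of the reversed polynomials. Pairing the recurrence with \<open>z\<close> times the tilde family, whose part of
  \<open>w\<close>-degree below \<open>m\<close> is orthogonal to \<open>\<Phi>\<close>, gives the second relation multiplied by \<open>A\<close>; the first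
  is the adjoint of the same relation with the variables exchanged.\<close>

section \<open>Laurent polynomials and their supports\<close>

lemma keys_ldagger: "Poly_Mapping.keys (ldagger p) = uminus ` Poly_Mapping.keys p"
proof (intro equalityI subsetI)
  fix k assume "k \<in> Poly_Mapping.keys (ldagger p)"
  then show "k \<in> uminus ` Poly_Mapping.keys p"
    by (intro image_eqI[of _ _ "- k"]) (simp_all add: in_keys_iff lookup_ldagger)
qed (auto simp: in_keys_iff lookup_ldagger)

lemma ldagger_ldagger [simp]: "ldagger (ldagger p) = p"
  by (simp add: poly_mapping_eq_iff fun_eq_iff lookup_ldagger)

lemma ldagger_add: "ldagger (p + q) = ldagger p + ldagger q"
  by (simp add: poly_mapping_eq_iff fun_eq_iff lookup_ldagger lookup_add)

lemma ldagger_lscale: "ldagger (lscale c p) = lscale (cnj c) (ldagger p)"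
  by (simp add: poly_mapping_eq_iff fun_eq_iff lookup_ldagger)

lemma ldagger_zero [simp]: "ldagger 0 = 0"
  by (simp add: poly_mapping_eq_iff fun_eq_iff lookup_ldagger)

lemma ldagger_sum: "ldagger (\<Sum>i\<in>I. p i) = (\<Sum>i\<in>I. ldagger (p i))"
  by (induction I rule: infinite_finite_induct) (simp_all add: ldagger_add)

lemma ldagger_single: "ldagger (Poly_Mapping.single k c) = Poly_Mapping.single (- k) (cnj c)"
proof (rule poly_mapping_eqI)
  fix l
  have "k = - l \<longleftrightarrow> - k = l" by (metis minus_minus)
  then show "Poly_Mapping.lookup (ldagger (Poly_Mapping.single k c)) l =
      Poly_Mapping.lookup (Poly_Mapping.single (- k) (cnj c)) l"
    by (simp add: lookup_ldagger lookup_single when_def)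
qed

lemma sum_single_lookup:
  "(\<Sum>k\<in>Poly_Mapping.keys p. Poly_Mapping.single k (Poly_Mapping.lookup p k)) = p"
proof -
  have "(\<Sum>a\<in>Poly_Mapping.keys p. Poly_Mapping.lookup p a when a = k) = Poly_Mapping.lookup p k" for k
    by (simp add: when_def in_keys_iff)
  then show ?thesis
    by (simp add: poly_mapping_eq_iff fun_eq_iff lookup_sum lookup_single)
qed

text \<open>Both factors are expanded into monomials; there the claim reduces to negation of
  exponents being additive and \<open>cnj\<close> being multiplicative.\<close>

lemma ldagger_mult: "ldagger (p * q) = ldagger p * ldagger q"
proof -
  have "ldagger (p * q) = ldagger
      ((\<Sum>a\<in>Poly_Mapping.keys p. Poly_Mapping.single a (Poly_Mapping.lookup p a)) *
       (\<Sum>b\<in>Poly_Mapping.keys q. Poly_Mapping.single b (Poly_Mapping.lookup q b)))"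
    by (simp only: sum_single_lookup)
  also have "\<dots> = ldagger p * ldagger q"
    by (simp add: ldagger_def[of p] ldagger_def[of q] sum_product ldagger_sum mult_single
        ldagger_single minus_add_distrib[symmetric] add.commute)
  finally show ?thesis .
qed

lemma lscale_mult: "lscale c p * q = lscale c (p * q)"
  and mult_lscale: "p * lscale c q = lscale c (p * q)"
  by (simp_all add: lscale_def mult_ac)

lemma lscale_single: "lscale c (Poly_Mapping.single k d) = Poly_Mapping.single k (c * d)"
  by (simp add: lscale_def mult_single)

lemma lookup_single_mult:
  "Poly_Mapping.lookup (Poly_Mapping.single a 1 * p) k = Poly_Mapping.lookup p (k - a :: int \<times> int)"
  for p :: laurent
proof -
  have "Poly_Mapping.single a 1 * p = Poly_Mapping.single a 1 *
     (\<Sum>b\<in>Poly_Mapping.keys p. Poly_Mapping.single b (Poly_Mapping.lookup p b))"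
    by (simp only: sum_single_lookup)
  then have "Poly_Mapping.lookup (Poly_Mapping.single a 1 * p) k =
      (\<Sum>b\<in>Poly_Mapping.keys p. if b = k - a then Poly_Mapping.lookup p b else 0)"
    by (simp add: sum_distrib_left mult_single lookup_sum lookup_single when_def eq_diff_eq add.commute
        cong: if_cong)
  then show ?thesis
    by (simp add: in_keys_iff)
qed

lemma keys_single_mult:
  "Poly_Mapping.keys (Poly_Mapping.single a 1 * p) = (+) a ` Poly_Mapping.keys p" for p :: laurent
proof (intro equalityI subsetI)
  fix k assume "k \<in> Poly_Mapping.keys (Poly_Mapping.single a 1 * p)"
  then show "k \<in> (+) a ` Poly_Mapping.keys p"
    by (intro image_eqI[of _ _ "k - a"]) (simp_all add: in_keys_iff lookup_single_mult)
next
  fix k assume "k \<in> (+) a ` Poly_Mapping.keys p"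
  then obtain b where "k = a + b" "b \<in> Poly_Mapping.keys p" by blast
  then show "k \<in> Poly_Mapping.keys (Poly_Mapping.single a 1 * p)"
    by (simp add: in_keys_iff lookup_single_mult)
qed

lemma keys_lscale_subset: "Poly_Mapping.keys (lscale c p) \<subseteq> Poly_Mapping.keys p"
  by (rule subsetI) (simp add: in_keys_iff)

lemma keys_add_subset:
  "Poly_Mapping.keys p \<subseteq> S \<Longrightarrow> Poly_Mapping.keys q \<subseteq> S \<Longrightarrow> Poly_Mapping.keys (p + q) \<subseteq> S"
  by (rule order.trans[OF Poly_Mapping.keys_add Un_least])

lemma keys_diff_subset:
  "Poly_Mapping.keys p \<subseteq> S \<Longrightarrow> Poly_Mapping.keys q \<subseteq> S \<Longrightarrow> Poly_Mapping.keys (p - q) \<subseteq> S"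
  by (rule order.trans[OF keys_diff Un_least])

lemma keys_sum_subset:
  assumes "\<And>i. i \<in> I \<Longrightarrow> Poly_Mapping.keys (p i) \<subseteq> S"
  shows "Poly_Mapping.keys (\<Sum>i\<in>I. p i) \<subseteq> S"
  using assms by (induction I rule: infinite_finite_induct) (simp_all add: keys_add_subset)

text \<open>Replaces membership in a span of monomials by an inclusion of supports, so that every
  later degree argument becomes an inclusion between sets of exponents.\<close>

lemma span_zw_monom:
  "laurent.span {zw_monom i j | i j. (i, j) \<in> S} = {p. Poly_Mapping.keys p \<subseteq> S}"
proof (intro equalityI subsetI)
  let ?Z = "{p. Poly_Mapping.keys p \<subseteq> S}"
  fix p assume "p \<in> laurent.span {zw_monom i j | i j. (i, j) \<in> S}"
  moreover have "laurent.subspace ?Z"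
    unfolding laurent.subspace_def
    by (simp add: keys_add_subset order.trans[OF keys_lscale_subset])
  moreover have "{zw_monom i j | i j. (i, j) \<in> S} \<subseteq> ?Z"
    by (auto simp: zw_monom_def)
  ultimately show "p \<in> ?Z"
    using laurent.span_minimal by blast
next
  fix p :: laurent assume "p \<in> {p. Poly_Mapping.keys p \<subseteq> S}"
  then have "(\<Sum>k\<in>Poly_Mapping.keys p. lscale (Poly_Mapping.lookup p k) (Poly_Mapping.single k 1))
      \<in> laurent.span {zw_monom i j | i j. (i, j) \<in> S}"
    by (intro laurent.span_sum laurent.span_scale laurent.span_base)
       (auto simp: zw_monom_def)
  then show "p \<in> laurent.span {zw_monom i j | i j. (i, j) \<in> S}"
    by (simp add: lscale_single sum_single_lookup)
qed

lemma orthonormal_for_iff: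
  "orthonormal_for L S k p \<longleftrightarrow>
     Poly_Mapping.keys p \<subseteq> S \<and> positive_real (Poly_Mapping.lookup p k) \<and> sinner L p p = 1 \<and>
     (\<forall>a\<in>S - {k}. sinner L p (Poly_Mapping.single a 1) = 0)"
  unfolding orthonormal_for_def span_zw_monom by (simp add: zw_monom_def split_beta)

section \<open>Orthonormal polynomials of a definite Hermitian functional\<close>

text \<open>Linearity and Hermitian symmetry are global, which frees the sesquilinear calculus from
  side conditions; only definiteness is confined to supports in \<open>B\<close>.\<close>

locale definite_functional =
  fixes L :: "laurent \<Rightarrow> complex" and B :: "(int \<times> int) set"
  assumes L_add: "L (p + q) = L p + L q"
    and L_lscale: "L (lscale c p) = c * L p"
    and L_ldagger: "L (ldagger p) = cnj (L p)"
    and positive: "Poly_Mapping.keys p \<subseteq> B \<Longrightarrow> p \<noteq> 0 \<Longrightarrow> positive_real (sinner L p p)"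
begin

lemma sinner_commute: "sinner L q p = cnj (sinner L p q)"
  unfolding sinner_def L_ldagger[symmetric] by (simp add: ldagger_mult mult.commute)

lemma sinner_add_left: "sinner L (p + q) r = sinner L p r + sinner L q r"
  by (simp add: sinner_def distrib_right L_add)

lemma sinner_lscale_left: "sinner L (lscale c p) r = c * sinner L p r"
  by (simp add: sinner_def lscale_mult L_lscale)

lemma sinner_add_right: "sinner L p (q + r) = sinner L p q + sinner L p r"
  by (simp add: sinner_def distrib_left L_add ldagger_add)

lemma sinner_lscale_right: "sinner L p (lscale c r) = cnj c * sinner L p r"
  by (simp add: sinner_def mult_lscale L_lscale ldagger_lscale)

lemma sinner_zero_left [simp]: "sinner L 0 r = 0"
  using sinner_lscale_left[of 0 0 r] by simp

lemma sinner_zero_right [simp]: "sinner L r 0 = 0"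
  using sinner_lscale_right[of r 0 0] by simp

lemma sinner_diff_left: "sinner L (p - q) r = sinner L p r - sinner L q r"
  using sinner_add_left[of "p - q" q r] by simp

lemma sinner_diff_right: "sinner L p (q - r) = sinner L p q - sinner L p r"
  using sinner_add_right[of p "q - r" r] by simp

lemma sinner_sum_left: "sinner L (\<Sum>i\<in>I. p i) r = (\<Sum>i\<in>I. sinner L (p i) r)"
  by (induction I rule: infinite_finite_induct) (simp_all add: sinner_add_left)

lemma sinner_sum_right: "sinner L r (\<Sum>i\<in>I. p i) = (\<Sum>i\<in>I. sinner L r (p i))"
  by (induction I rule: infinite_finite_induct) (simp_all add: sinner_add_right)

lemma sinner_eq_0_if_monomials:
  assumes "\<And>k. k \<in> Poly_Mapping.keys q \<Longrightarrow> sinner L p (Poly_Mapping.single k 1) = 0"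
  shows "sinner L p q = 0"
proof -
  have "sinner L p (\<Sum>k\<in>Poly_Mapping.keys q.
      lscale (Poly_Mapping.lookup q k) (Poly_Mapping.single k 1)) = 0"
    unfolding sinner_sum_right sinner_lscale_right using assms by simp
  then show ?thesis
    by (simp add: lscale_single sum_single_lookup)
qed

lemma sinner_self_eq_0: "Poly_Mapping.keys p \<subseteq> B \<Longrightarrow> sinner L p p = 0 \<Longrightarrow> p = 0"
  using positive[of p] by (force simp: positive_real_def)

text \<open>A monomial times its own dagger is 1, so multiplication by a monomial is an
  isometry.\<close>

lemma sinner_single_mult:
  "sinner L (Poly_Mapping.single a 1 * p) (Poly_Mapping.single a 1 * q) = sinner L p q"
proof -
  have "Poly_Mapping.single a 1 * p * (Poly_Mapping.single (- a) 1 * ldagger q) =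
      (Poly_Mapping.single a 1 * Poly_Mapping.single (- a) 1) * (p * ldagger q)"
    by (simp only: mult_ac)
  then show ?thesis
    by (simp add: sinner_def ldagger_mult ldagger_single mult_single)
qed

text \<open>Gram-Schmidt by induction on \<open>S\<close>. The vector \<open>v\<close> is arbitrary
  because the induction hypothesis is applied both to \<open>v\<close> and to the monomial being
  added.\<close>

lemma projection_exists:
  assumes "finite S" "S \<subseteq> B"
  shows "\<exists>u. Poly_Mapping.keys u \<subseteq> S \<and>
    (\<forall>k\<in>S. sinner L (v - u) (Poly_Mapping.single k 1) = 0)"
  using assms
proof (induction S arbitrary: v rule: finite_induct)
  case empty
  show ?case by (intro exI[of _ 0]) simp
next
  case (insert x S)
  obtain u where u: "Poly_Mapping.keys u \<subseteq> S"
    "\<And>k. k \<in> S \<Longrightarrow> sinner L (v - u) (Poly_Mapping.single k 1) = 0"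
    using insert.IH[of v] insert.prems by blast
  obtain y where y: "Poly_Mapping.keys y \<subseteq> S"
    "\<And>k. k \<in> S \<Longrightarrow> sinner L (Poly_Mapping.single x 1 - y) (Poly_Mapping.single k 1) = 0"
    using insert.IH[of "Poly_Mapping.single x 1"] insert.prems by blast
  define t where "t = Poly_Mapping.single x (1::complex) - y"
  have keys_t: "Poly_Mapping.keys t \<subseteq> insert x S"
    unfolding t_def using y(1) by (intro keys_diff_subset) auto
  \<comment> \<open>Since \<open>x\<close> lies outside \<open>S\<close>, subtracting
    \<open>y\<close> does not touch this coefficient. Hence \<open>t\<close> is nonzero, and
    definiteness permits division by \<open>sinner L t t\<close>.\<close>
  have "Poly_Mapping.lookup t x = 1"
    using y(1) insert.hyps by (auto simp: t_def lookup_minus in_keys_iff)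
  then have "t \<noteq> 0" by auto
  then have d: "sinner L t t \<noteq> 0"
    using sinner_self_eq_0[of t] keys_t insert.prems by blast
  define c where "c = sinner L (v - u) t / sinner L t t"
  define w where "w = v - (u + lscale c t)"
  have w: "w = (v - u) - lscale c t" by (simp add: w_def)
  have on_S: "sinner L w (Poly_Mapping.single k 1) = 0" if "k \<in> S" for k
    using u(2)[OF that] y(2)[OF that]
    by (simp add: w sinner_diff_left[of "v - u"] sinner_lscale_left t_def)
  have "sinner L w t = 0"
    using d by (simp add: w sinner_diff_left[of "v - u"] sinner_lscale_left c_def)
  \<comment> \<open>The added monomial is \<open>t + y\<close> with \<open>y\<close> supported on
    \<open>S\<close>, so orthogonality to both summands gives the missing condition at
    \<open>x\<close>.\<close>
  moreover have "sinner L w y = 0"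
    using on_S subsetD[OF y(1)] by (simp add: sinner_eq_0_if_monomials)
  ultimately have "sinner L w (Poly_Mapping.single x 1) = 0"
    by (simp add: t_def sinner_diff_right)
  moreover have "Poly_Mapping.keys (u + lscale c t) \<subseteq> insert x S"
    using u(1) order.trans[OF keys_lscale_subset keys_t, of c] by (simp add: keys_add_subset subset_insertI2)
  ultimately show ?case
    using on_S by (intro exI[of _ "u + lscale c t"]) (simp add: w_def)
qed

lemma orthonormal_for_sinner_eq_0:
  assumes "orthonormal_for L S k p" "Poly_Mapping.keys g \<subseteq> S - {k}"
  shows "sinner L p g = 0"
  using assms(1) subsetD[OF assms(2)] unfolding orthonormal_for_iff
  by (simp add: sinner_eq_0_if_monomials)

text \<open>Subtracting from \<open>g\<close> the multiple of \<open>p\<close> that cancels the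
  coefficient at \<open>k\<close> leaves a vector orthogonal to \<open>p\<close>; as
  \<open>p\<close> has norm one, that multiple is the inner product.\<close>

lemma orthonormal_for_sinner_lead:
  assumes p: "orthonormal_for L S k p" and g: "Poly_Mapping.keys g \<subseteq> S"
  shows "sinner L g p * Poly_Mapping.lookup p k = Poly_Mapping.lookup g k"
proof -
  have lead: "Poly_Mapping.lookup p k \<noteq> 0" and keys: "Poly_Mapping.keys p \<subseteq> S"
    and norm: "sinner L p p = 1"
    using p by (force simp: orthonormal_for_iff positive_real_def)+
  define c where "c = Poly_Mapping.lookup g k / Poly_Mapping.lookup p k"
  have "Poly_Mapping.keys (g - lscale c p) \<subseteq> S"
    using g order.trans[OF keys_lscale_subset keys] by (rule keys_diff_subset)
  moreover have "k \<notin> Poly_Mapping.keys (g - lscale c p)"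
    using lead by (simp add: in_keys_iff lookup_minus c_def)
  ultimately have "sinner L p (g - lscale c p) = 0"
    by (intro orthonormal_for_sinner_eq_0[OF p]) blast
  then have "sinner L (g - lscale c p) p = 0"
    by (subst sinner_commute) simp
  then show ?thesis
    using lead by (simp add: sinner_diff_left sinner_lscale_left norm c_def)
qed

text \<open>The leading monomial minus its projection onto the span of the others has coefficient 1
  at \<open>k\<close>, so it is nonzero and can be normalised.\<close>

lemma orthonormal_for_exists:
  assumes "finite S" "S \<subseteq> B" "k \<in> S"
  shows "\<exists>p. orthonormal_for L S k p"
proof -
  obtain u where u: "Poly_Mapping.keys u \<subseteq> S - {k}"
    "\<And>a. a \<in> S - {k} \<Longrightarrow> sinner L (Poly_Mapping.single k 1 - u) (Poly_Mapping.single a 1) = 0"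
    using projection_exists[of "S - {k}" "Poly_Mapping.single k 1"] assms by blast
  define w where "w = Poly_Mapping.single k (1::complex) - u"
  have keys: "Poly_Mapping.keys w \<subseteq> S"
    unfolding w_def using u(1) assms by (intro keys_diff_subset) auto
  have lead: "Poly_Mapping.lookup w k = 1"
    using u(1) by (auto simp: w_def lookup_minus in_keys_iff)
  then have "w \<noteq> 0" by auto
  then have "positive_real (sinner L w w)"
    using keys assms by (intro positive) auto
  then obtain d where d: "sinner L w w = complex_of_real d" "0 < d"
    by (metis Reals_cases Re_complex_of_real positive_real_def)
  have "complex_of_real (sqrt d) * complex_of_real (sqrt d) = complex_of_real d"
    using d by (simp flip: of_real_mult)
  then have "orthonormal_for L S k (lscale (of_real (1 / sqrt d)) w)"
    unfolding orthonormal_for_iff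
    using d u(2) order.trans[OF keys_lscale_subset keys]
    by (simp add: sinner_lscale_left sinner_lscale_right lead positive_real_def field_simps
        flip: w_def)
  then show ?thesis ..
qed

text \<open>With leading coefficients \<open>a\<close> and \<open>b\<close>, the identity for
  leading coefficients is used in both directions: the inner product is \<open>b / a\<close> and its
  conjugate is \<open>a / b\<close>. Positivity forces \<open>a = b\<close>, the inner product is 1,
  and \<open>p - q\<close> has norm zero.\<close>

lemma orthonormal_for_unique:
  assumes "S \<subseteq> B" and p: "orthonormal_for L S k p" and q: "orthonormal_for L S k q"
  shows "p = q"
proof -
  have keys: "Poly_Mapping.keys p \<subseteq> S" "Poly_Mapping.keys q \<subseteq> S"
    and norm: "sinner L p p = 1" "sinner L q q = 1"
    and pos: "positive_real (Poly_Mapping.lookup p k)" "positive_real (Poly_Mapping.lookup q k)"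
    using p q by (simp_all add: orthonormal_for_iff)
  define a b where "a = Re (Poly_Mapping.lookup p k)" and "b = Re (Poly_Mapping.lookup q k)"
  have ab: "Poly_Mapping.lookup p k = of_real a" "Poly_Mapping.lookup q k = of_real b" "0 < a" "0 < b"
    using pos by (auto simp: a_def b_def positive_real_def)
  have 1: "sinner L q p * of_real a = of_real b"
    using orthonormal_for_sinner_lead[OF p keys(2)] ab by simp
  have 2: "cnj (sinner L q p) * of_real b = of_real a"
    using orthonormal_for_sinner_lead[OF q keys(1)] ab by (simp flip: sinner_commute)
  have s: "sinner L q p = of_real (b / a)"
    using 1 ab by (simp add: field_simps)
  then have "complex_of_real (b / a * b) = of_real a"
    using 2 by simp
  then have "b / a * b = a"
    by (simp only: of_real_eq_iff)
  then have "b * b = a * a"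
    using ab by (simp add: field_simps)
  then have "a = b"
    using ab by (metis less_imp_le power2_eq_square power2_eq_imp_eq)
  then have s1: "sinner L q p = 1" "sinner L p q = 1"
    using s ab sinner_commute[of p q] by simp_all
  have "p - q = 0"
    using keys_diff_subset[OF keys] assms(1)
    by (intro sinner_self_eq_0) (simp_all add: sinner_diff_left sinner_diff_right norm s1)
  then show ?thesis by simp
qed

lemma orthonormal_for_The:
  assumes "finite S" "S \<subseteq> B" "k \<in> S"
  shows "orthonormal_for L S k (THE p. orthonormal_for L S k p)"
  using orthonormal_for_exists[OF assms] orthonormal_for_unique[OF assms(2)] by (metis the_equality)

end

section \<open>The recurrence in either variable\<close>

text \<open>For \<open>\<sigma> = id\<close> this is \<open>phi L l n m\<close>, for the swap it is
  \<open>phit L l m n\<close>: the first degree argument always belongs to the variable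
  \<open>\<sigma> (1, 0)\<close>.\<close>

definition oriented_phi :: "(laurent \<Rightarrow> complex) \<Rightarrow> (int \<times> int \<Rightarrow> int \<times> int) \<Rightarrow> int \<Rightarrow> int \<Rightarrow> int \<Rightarrow> laurent"
  where "oriented_phi L \<sigma> n m l =
    (THE p. orthonormal_for L (\<sigma> ` ({0..<n} \<times> {0..m} \<union> {n} \<times> {0..l})) (\<sigma> (n, l)) p)"

section \<open>Reversal as an antiunitary involution\<close>

definition reversal :: "int \<times> int \<Rightarrow> laurent \<Rightarrow> laurent" where
  "reversal k p = Poly_Mapping.single k 1 * ldagger p"

lemma reversal_reversal [simp]: "reversal k (reversal k p) = p"
proof -
  have "reversal k (reversal k p) = (Poly_Mapping.single k 1 * Poly_Mapping.single (- k) 1) * p"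
    unfolding reversal_def ldagger_mult ldagger_single ldagger_ldagger by (simp only: complex_cnj_one mult_ac)
  then show ?thesis by (simp add: mult_single)
qed

lemma reversal_lscale: "reversal k (lscale c p) = lscale (cnj c) (reversal k p)"
  by (simp add: reversal_def ldagger_lscale mult_lscale)

lemma reversal_sum: "reversal k (\<Sum>i\<in>I. p i) = (\<Sum>i\<in>I. reversal k (p i))"
  by (simp add: reversal_def ldagger_sum sum_distrib_left)

lemma keys_reversal: "Poly_Mapping.keys (reversal k p) = (\<lambda>a. k - a) ` Poly_Mapping.keys p"
  by (simp add: reversal_def keys_single_mult keys_ldagger image_image)

text \<open>The two monomial factors cancel and the daggers change places, which exchanges the
  arguments.\<close>

lemma sinner_reversal: "sinner L (reversal k p) (reversal k q) = sinner L q p"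
proof -
  have "reversal k p * ldagger (reversal k q) =
      (Poly_Mapping.single k 1 * Poly_Mapping.single (- k) 1) * (q * ldagger p)"
    unfolding reversal_def ldagger_mult ldagger_single ldagger_ldagger by (simp only: complex_cnj_one mult_ac)
  then show ?thesis by (simp add: sinner_def mult_single)
qed

locale oriented_functional = definite_functional +
  fixes \<sigma> :: "int \<times> int \<Rightarrow> int \<times> int"
  assumes \<sigma>_add: "\<sigma> (a + b) = \<sigma> a + \<sigma> b"
    and inj_\<sigma>: "inj \<sigma>"
begin

abbreviation low :: "int \<Rightarrow> int \<Rightarrow> (int \<times> int) set" where
  "low n m \<equiv> \<sigma> ` ({0..<n} \<times> {0..m})"

abbreviation box :: "int \<Rightarrow> int \<Rightarrow> (int \<times> int) set" where
  "box n m \<equiv> \<sigma> ` ({0..n} \<times> {0..m})"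

abbreviation monomials_upto :: "int \<Rightarrow> int \<Rightarrow> int \<Rightarrow> (int \<times> int) set" where
  "monomials_upto n m l \<equiv> \<sigma> ` ({0..<n} \<times> {0..m} \<union> {n} \<times> {0..l})"

abbreviation \<phi> :: "int \<Rightarrow> int \<Rightarrow> int \<Rightarrow> laurent" where
  "\<phi> n m l \<equiv> oriented_phi L \<sigma> n m l"

lemma \<sigma>_diff: "\<sigma> (a - b) = \<sigma> a - \<sigma> b"
  using \<sigma>_add[of "a - b" b] by simp

lemma \<sigma>_shift: "\<sigma> (i, j) + \<sigma> (i', j') = \<sigma> (i + i', j + j')"
  by (simp flip: \<sigma>_add)

lemma \<sigma>_reflect: "\<sigma> (i, j) - \<sigma> (i', j') = \<sigma> (i - i', j - j')"
  by (simp flip: \<sigma>_diff)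

lemma \<sigma>_mem: "\<sigma> x \<in> \<sigma> ` A \<longleftrightarrow> x \<in> A"
  using inj_\<sigma> by (rule inj_image_mem_iff)

lemma upto_subset_box: "0 \<le> n \<Longrightarrow> l \<le> m \<Longrightarrow> monomials_upto n m l \<subseteq> box n m"
  by (rule image_mono) auto

lemma low_subset_box: "low n m \<subseteq> box n m"
  by (rule image_mono) auto

text \<open>Lets the part left over at level \<open>n\<close> be treated as a full box at level
  \<open>n - 1\<close>, where the expansion can be repeated.\<close>

lemma low_eq_box: "low n m = box (n - 1) m"
proof -
  have "{0..<n} = {0..n - 1}" by auto
  then show ?thesis by simp
qed

section \<open>Orthonormality and expansion at one fixed level\<close>

context
  fixes n m :: int
  assumes n: "0 \<le> n" and box: "box n m \<subseteq> B"
begin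

lemma orthonormal_\<phi>:
  assumes "l \<in> {0..m}"
  shows "orthonormal_for L (monomials_upto n m l) (\<sigma> (n, l)) (\<phi> n m l)"
  unfolding oriented_phi_def
proof (rule orthonormal_for_The)
  show "monomials_upto n m l \<subseteq> B"
    using upto_subset_box[of n l m] n box assms by (meson atLeastAtMost_iff order.trans)
  show "\<sigma> (n, l) \<in> monomials_upto n m l"
    using assms by (intro imageI) simp
qed simp

lemma keys_\<phi>: "l \<in> {0..m} \<Longrightarrow> Poly_Mapping.keys (\<phi> n m l) \<subseteq> monomials_upto n m l"
  using orthonormal_\<phi> by (simp add: orthonormal_for_iff)

lemma keys_\<phi>_box: "l \<in> {0..m} \<Longrightarrow> Poly_Mapping.keys (\<phi> n m l) \<subseteq> box n m"
  using keys_\<phi> upto_subset_box[of n l m] n by (meson atLeastAtMost_iff order.trans)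

lemma lookup_\<phi>_lead: "l \<in> {0..m} \<Longrightarrow> Poly_Mapping.lookup (\<phi> n m l) (\<sigma> (n, l)) \<noteq> 0"
  using orthonormal_\<phi> by (force simp: orthonormal_for_iff positive_real_def)

lemma sinner_\<phi>_low:
  assumes "l \<in> {0..m}" "Poly_Mapping.keys g \<subseteq> low n m"
  shows "sinner L (\<phi> n m l) g = 0"
proof (rule orthonormal_for_sinner_eq_0[OF orthonormal_\<phi>[OF assms(1)]])
  have "low n m \<subseteq> monomials_upto n m l - {\<sigma> (n, l)}"
    using \<sigma>_mem[of "(n, l)" "{0..<n} \<times> {0..m}"] by (simp add: image_Un subset_insert_iff) blast
  then show "Poly_Mapping.keys g \<subseteq> monomials_upto n m l - {\<sigma> (n, l)}"
    using assms(2) by (rule order.trans[rotated])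
qed

lemma upto_less_subset: "k < l \<Longrightarrow> monomials_upto n m k \<subseteq> monomials_upto n m l - {\<sigma> (n, l)}"
proof -
  assume "k < l"
  moreover from this have "\<sigma> (n, l) \<notin> monomials_upto n m k"
    by (simp add: \<sigma>_mem)
  moreover from \<open>k < l\<close> have "monomials_upto n m k \<subseteq> monomials_upto n m l"
    by (intro image_mono) auto
  ultimately show ?thesis by blast
qed

lemma sinner_\<phi>_upto:
  assumes "l \<in> {0..m}" "k < l" "Poly_Mapping.keys g \<subseteq> monomials_upto n m k"
  shows "sinner L (\<phi> n m l) g = 0"
  using assms(3) upto_less_subset[OF assms(2)]
  by (intro orthonormal_for_sinner_eq_0[OF orthonormal_\<phi>[OF assms(1)]]) (rule order.trans)

text \<open>For different superscripts, the polynomial with the larger one is orthogonal to the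
  other, whose support contains only non-leading monomials of the former.\<close>

lemma sinner_\<phi>_\<phi>:
  assumes "k \<in> {0..m}" "l \<in> {0..m}"
  shows "sinner L (\<phi> n m k) (\<phi> n m l) = (if k = l then 1 else 0)"
proof (cases k l rule: linorder_cases)
  case equal
  then show ?thesis
    using orthonormal_\<phi>[OF assms(1)] by (simp add: orthonormal_for_iff)
next
  case less
  then show ?thesis
    using sinner_\<phi>_upto[OF assms(2) less keys_\<phi>[OF assms(1)]]
    by (subst sinner_commute) simp
next
  case greater
  then show ?thesis
    using sinner_\<phi>_upto[OF assms(1) greater keys_\<phi>[OF assms(2)]] by simp
qed

lemma sinner_\<phi>_lead:
  assumes "l \<in> {0..m}" "Poly_Mapping.keys g \<subseteq> monomials_upto n m l"
  shows "sinner L g (\<phi> n m l) * Poly_Mapping.lookup (\<phi> n m l) (\<sigma> (n, l)) =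
    Poly_Mapping.lookup g (\<sigma> (n, l))"
  by (rule orthonormal_for_sinner_lead[OF orthonormal_\<phi>[OF assms(1)] assms(2)])

text \<open>Otherwise let \<open>l\<close> be the largest index with \<open>\<sigma> (n, l)\<close>
  in the support of the remainder. The remainder then lies in the space defining
  \<open>\<phi> n m l\<close> and is orthogonal to that polynomial, so
  \<open>sinner_\<phi>_lead\<close> makes its coefficient at \<open>\<sigma> (n, l)\<close> vanish,
  a contradiction.\<close>

lemma keys_residue_low:
  assumes g: "Poly_Mapping.keys g \<subseteq> box n m"
  shows "Poly_Mapping.keys (g - (\<Sum>l\<in>{0..m}. lscale (sinner L g (\<phi> n m l)) (\<phi> n m l))) \<subseteq> low n m"
    (is "Poly_Mapping.keys ?q \<subseteq> _")
proof (rule ccontr)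
  assume not_low: "\<not> Poly_Mapping.keys ?q \<subseteq> low n m"
  have keys_q: "Poly_Mapping.keys ?q \<subseteq> box n m"
    using g by (intro keys_diff_subset keys_sum_subset order.trans[OF keys_lscale_subset] keys_\<phi>_box)
  have orth: "sinner L ?q (\<phi> n m l) = 0" if "l \<in> {0..m}" for l
  proof -
    have "(\<Sum>k\<in>{0..m}. sinner L g (\<phi> n m k) * sinner L (\<phi> n m k) (\<phi> n m l)) =
        (\<Sum>k\<in>{0..m}. if k = l then sinner L g (\<phi> n m k) else 0)"
      using that by (intro sum.cong) (simp_all add: sinner_\<phi>_\<phi>)
    then show ?thesis
      using that by (simp add: sinner_diff_left sinner_sum_left sinner_lscale_left)
  qed
  define T where "T = {0..m} \<inter> {l. \<sigma> (n, l) \<in> Poly_Mapping.keys ?q}"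
  have fin: "finite T" by (simp add: T_def)
  have "T \<noteq> {}"
  proof -
    obtain i j where "\<sigma> (i, j) \<in> Poly_Mapping.keys ?q" "\<sigma> (i, j) \<notin> low n m"
      "i \<in> {0..n}" "j \<in> {0..m}"
      using not_low keys_q by blast
    then have "j \<in> T" by (auto simp: T_def \<sigma>_mem)
    then show ?thesis by blast
  qed
  then have Max_mem: "Max T \<in> T"
    by (rule Max_in[OF fin])
  define l where "l = Max T"
  have l: "l \<in> {0..m}" "\<sigma> (n, l) \<in> Poly_Mapping.keys ?q"
    using Max_mem[folded l_def] by (simp_all add: T_def)
  have "Poly_Mapping.keys ?q \<subseteq> monomials_upto n m l"
  proof
    fix k assume k: "k \<in> Poly_Mapping.keys ?q"
    then obtain i j where ij: "k = \<sigma> (i, j)" "i \<in> {0..n}" "j \<in> {0..m}"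
      using keys_q by blast
    have "j \<le> l" if "i = n"
    proof -
      have "j \<in> T"
        unfolding T_def using that k ij by blast
      then show ?thesis
        unfolding l_def by (rule Max_ge[OF fin])
    qed
    then have "(i, j) \<in> {0..<n} \<times> {0..m} \<union> {n} \<times> {0..l}"
      using ij(2,3) by auto
    then show "k \<in> monomials_upto n m l"
      unfolding ij(1) by (rule imageI)
  qed
  from sinner_\<phi>_lead[OF l(1) this] orth[OF l(1)] l(2) show False
    by (simp add: in_keys_iff)
qed

end

section \<open>Shifting by the first variable, and the recurrence\<close>

lemma keys_shift_\<phi>:
  assumes "1 \<le> n" "box (n - 1) m \<subseteq> B" "l \<in> {0..m}"
  shows "Poly_Mapping.keys (Poly_Mapping.single (\<sigma> (1, 0)) 1 * \<phi> (n - 1) m l) \<subseteq> monomials_upto n m l"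
proof
  fix k assume "k \<in> Poly_Mapping.keys (Poly_Mapping.single (\<sigma> (1, 0)) 1 * \<phi> (n - 1) m l)"
  moreover have "Poly_Mapping.keys (\<phi> (n - 1) m l) \<subseteq> monomials_upto (n - 1) m l"
    using assms by (intro keys_\<phi>) simp_all
  ultimately obtain i j where "k = \<sigma> (1, 0) + \<sigma> (i, j)"
    "(i, j) \<in> {0..<n - 1} \<times> {0..m} \<union> {n - 1} \<times> {0..l}"
    unfolding keys_single_mult by blast
  then show "k \<in> monomials_upto n m l"
    by (auto simp: \<sigma>_shift \<sigma>_mem)
qed

text \<open>The shifted polynomial uses only monomials up to \<open>\<sigma> (n, l)\<close>, to
  which \<open>\<phi> n m k\<close> with larger \<open>k\<close> is orthogonal.\<close>

lemma A_triangular: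
  assumes "1 \<le> n" "box n m \<subseteq> B" "k \<in> {0..m}" "l \<in> {0..m}" "l < k"
  shows "sinner L (Poly_Mapping.single (\<sigma> (1, 0)) 1 * \<phi> (n - 1) m l) (\<phi> n m k) = 0"
proof -
  have "box (n - 1) m \<subseteq> B"
    using assms(2) low_subset_box[of n m] unfolding low_eq_box by (rule order.trans[rotated])
  then have "sinner L (\<phi> n m k) (Poly_Mapping.single (\<sigma> (1, 0)) 1 * \<phi> (n - 1) m l) = 0"
    using assms by (intro sinner_\<phi>_upto[of n m k l] keys_shift_\<phi>) simp_all
  then show ?thesis
    by (subst sinner_commute) simp
qed

text \<open>The entry is the quotient of the leading coefficients at levels \<open>n - 1\<close> and
  \<open>n\<close>.\<close>

lemma A_diagonal:
  assumes "1 \<le> n" "box n m \<subseteq> B" "l \<in> {0..m}"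
  shows "sinner L (Poly_Mapping.single (\<sigma> (1, 0)) 1 * \<phi> (n - 1) m l) (\<phi> n m l) \<noteq> 0"
proof -
  have box': "box (n - 1) m \<subseteq> B"
    using assms(2) low_subset_box[of n m] unfolding low_eq_box by (rule order.trans[rotated])
  have "sinner L (Poly_Mapping.single (\<sigma> (1, 0)) 1 * \<phi> (n - 1) m l) (\<phi> n m l) *
      Poly_Mapping.lookup (\<phi> n m l) (\<sigma> (n, l)) =
      Poly_Mapping.lookup (Poly_Mapping.single (\<sigma> (1, 0)) 1 * \<phi> (n - 1) m l) (\<sigma> (n, l))"
    using assms box' by (intro sinner_\<phi>_lead keys_shift_\<phi>) simp_all
  also have "\<dots> = Poly_Mapping.lookup (\<phi> (n - 1) m l) (\<sigma> (n - 1, l))"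
    by (simp add: lookup_single_mult \<sigma>_reflect)
  finally show ?thesis
    using lookup_\<phi>_lead[of "n - 1" m l] assms box' by auto
qed

lemma keys_reversal_box:
  assumes "Poly_Mapping.keys p \<subseteq> box n m"
  shows "Poly_Mapping.keys (reversal (\<sigma> (n, m)) p) \<subseteq> box n m"
proof
  fix k assume "k \<in> Poly_Mapping.keys (reversal (\<sigma> (n, m)) p)"
  then obtain i j where "k = \<sigma> (n, m) - \<sigma> (i, j)" "i \<in> {0..n}" "j \<in> {0..m}"
    using assms unfolding keys_reversal by blast
  then show "k \<in> box n m"
    by (simp add: \<sigma>_reflect \<sigma>_mem)
qed

text \<open>Two expansions in succession: first \<open>p\<close> along level \<open>n\<close>,
  leaving \<open>q\<close>; then the reversal of \<open>q\<close> along level \<open>n - 1\<close>,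
  leaving \<open>g\<close>. The work lies in showing \<open>g = 0\<close>.\<close>

lemma \<phi>_recurrence:
  assumes n: "1 \<le> n" and box: "box n m \<subseteq> B" and l: "l \<in> {0..m}"
  defines "p \<equiv> Poly_Mapping.single (\<sigma> (1, 0)) 1 * \<phi> (n - 1) m l"
  shows "p = (\<Sum>k\<in>{0..m}. lscale (sinner L p (\<phi> n m k)) (\<phi> n m k)) +
    (\<Sum>k\<in>{0..m}. lscale (sinner L p (reversal (\<sigma> (n - 1, m)) (\<phi> (n - 1) m k)))
       (reversal (\<sigma> (n - 1, m)) (\<phi> (n - 1) m k)))"
proof -
  let ?rev = "reversal (\<sigma> (n - 1, m))"
  have n0: "0 \<le> n" and n1: "0 \<le> n - 1" using n by simp_all
  have box': "box (n - 1) m \<subseteq> B"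
    using box low_subset_box[of n m] unfolding low_eq_box by (rule order.trans[rotated])
  have "monomials_upto n m l \<subseteq> box n m"
    using n l by (intro upto_subset_box) simp_all
  then have keys_p: "Poly_Mapping.keys p \<subseteq> box n m"
    unfolding p_def using keys_shift_\<phi>[OF n box' l] by (rule order.trans[rotated])
  define q where "q = p - (\<Sum>k\<in>{0..m}. lscale (sinner L p (\<phi> n m k)) (\<phi> n m k))"
  have keys_q: "Poly_Mapping.keys q \<subseteq> low n m"
    unfolding q_def by (rule keys_residue_low[OF n0 box keys_p])
  have q_low: "sinner L q g = sinner L p g" if "Poly_Mapping.keys g \<subseteq> low n m" for g
    using that
    by (simp add: q_def sinner_diff_left sinner_sum_left sinner_lscale_left sinner_\<phi>_low[OF n0 box])
  define c where "c k = sinner L (?rev q) (\<phi> (n - 1) m k)" for k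
  define g where "g = ?rev q - (\<Sum>k\<in>{0..m}. lscale (c k) (\<phi> (n - 1) m k))"
  have keys_g: "Poly_Mapping.keys g \<subseteq> low (n - 1) m"
    unfolding g_def c_def using keys_q unfolding low_eq_box
    by (intro keys_residue_low[OF n1 box', unfolded low_eq_box] keys_reversal_box)
  \<comment> \<open>The degree of \<open>g\<close> is at most \<open>n - 2\<close>, so its reversal
    has all degrees at least 1 and is divisible by the shift monomial.\<close>
  have keys_rev_g: "\<exists>i j. k = \<sigma> (i, j) \<and> i \<in> {1..n - 1} \<and> j \<in> {0..m}"
    if k: "k \<in> Poly_Mapping.keys (?rev g)" for k
  proof -
    obtain i j where "k = \<sigma> (n - 1, m) - \<sigma> (i, j)" "i \<in> {0..<n - 1}" "j \<in> {0..m}"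
      using k keys_g unfolding keys_reversal by blast
    then show ?thesis
      by (intro exI[of _ "n - 1 - i"] exI[of _ "m - j"]) (simp add: \<sigma>_reflect)
  qed
  \<comment> \<open>Quotient of the reversal of \<open>g\<close> by the shift monomial. The isometry
    property turns the pairing with \<open>p\<close> into one of \<open>\<phi> (n - 1) m l\<close>
    with \<open>h\<close>, which is zero because \<open>h\<close> has degree below
    \<open>n - 1\<close>.\<close>
  define h where "h = Poly_Mapping.single (- \<sigma> (1, 0)) 1 * ?rev g"
  have rev_g: "?rev g = Poly_Mapping.single (\<sigma> (1, 0)) 1 * h"
    by (simp add: h_def mult_single flip: mult.assoc)
  have "Poly_Mapping.keys h \<subseteq> low (n - 1) m"
  proof
    fix k assume "k \<in> Poly_Mapping.keys h"
    then obtain a where "k = - \<sigma> (1, 0) + a" "a \<in> Poly_Mapping.keys (?rev g)"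
      unfolding h_def keys_single_mult by blast
    with keys_rev_g obtain i j where "k = \<sigma> (i, j) - \<sigma> (1, 0)" "i \<in> {1..n - 1}" "j \<in> {0..m}"
      by (metis add.commute uminus_add_conv_diff)
    then show "k \<in> low (n - 1) m"
      by (simp add: \<sigma>_reflect \<sigma>_mem)
  qed
  then have "sinner L p (?rev g) = 0"
    unfolding p_def rev_g sinner_single_mult by (intro sinner_\<phi>_low[OF n1 box' l])
  moreover have "Poly_Mapping.keys (?rev g) \<subseteq> low n m"
  proof
    fix k assume "k \<in> Poly_Mapping.keys (?rev g)"
    from keys_rev_g[OF this] obtain i j where "k = \<sigma> (i, j)" "i \<in> {1..n - 1}" "j \<in> {0..m}"
      by blast
    then show "k \<in> low n m"
      by (simp add: \<sigma>_mem)
  qed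
  ultimately have "sinner L q (?rev g) = 0"
    by (simp add: q_low)
  then have "sinner L (?rev q) g = 0"
    using sinner_reversal[of L "\<sigma> (n - 1, m)" q "?rev g"] sinner_commute[of "?rev g" q] by simp
  \<comment> \<open>The definition of \<open>g\<close> is unfolded in the first argument only: the
    reversal of \<open>q\<close> and all of level \<open>n - 1\<close> are orthogonal to
    \<open>g\<close>.\<close>
  then have "sinner L g g = 0"
    using sinner_\<phi>_low[OF n1 box' _ keys_g]
    by (simp add: g_def[THEN arg_cong, of "\<lambda>x. sinner L x g"] sinner_diff_left sinner_sum_left
        sinner_lscale_left)
  moreover have "Poly_Mapping.keys g \<subseteq> B"
    using keys_g low_subset_box[of "n - 1" m] box' by (meson order.trans)
  ultimately have "g = 0"
    using sinner_self_eq_0 by blast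
  then have "?rev q = (\<Sum>k\<in>{0..m}. lscale (c k) (\<phi> (n - 1) m k))"
    by (simp add: g_def)
  then have "?rev (?rev q) = (\<Sum>k\<in>{0..m}. lscale (cnj (c k)) (?rev (\<phi> (n - 1) m k)))"
    by (simp only: reversal_sum reversal_lscale)
  \<comment> \<open>Antiunitarity carries the coefficient back to \<open>q\<close>, and
    \<open>p\<close> may replace \<open>q\<close> because level \<open>n\<close> is orthogonal to
    everything of degree below \<open>n\<close>.\<close>
  moreover have "cnj (c k) = sinner L p (?rev (\<phi> (n - 1) m k))" if "k \<in> {0..m}" for k
  proof -
    have "cnj (c k) = sinner L q (?rev (\<phi> (n - 1) m k))"
      using sinner_reversal[of L "\<sigma> (n - 1, m)" q "?rev (\<phi> (n - 1) m k)"]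
      by (simp add: c_def flip: sinner_commute)
    then show ?thesis
      using that keys_reversal_box[OF keys_\<phi>_box[OF n1 box']] by (simp add: q_low low_eq_box)
  qed
  ultimately have "q = (\<Sum>k\<in>{0..m}. lscale (sinner L p (?rev (\<phi> (n - 1) m k))) (?rev (\<phi> (n - 1) m k)))"
    by simp
  then show ?thesis
    by (simp add: q_def diff_eq_eq add.commute)
qed

end

text \<open>Both sides apply \<open>L\<close> to the monomial with exponent \<open>a - b\<close>
  times \<open>p * q\<close>, an expression symmetric in \<open>p\<close> and
  \<open>q\<close>.\<close>

lemma sinner_shift_reversal:
  assumes "a - b = a' - b'"
  shows "sinner L (Poly_Mapping.single a 1 * p) (reversal b q) =
    sinner L (Poly_Mapping.single a' 1 * q) (reversal b' p)"
proof -
  have "Poly_Mapping.single a 1 * p * ldagger (reversal b q) =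
      (Poly_Mapping.single a 1 * Poly_Mapping.single (- b) 1) * (p * q)" for a b and p q :: laurent
    unfolding reversal_def ldagger_mult ldagger_single ldagger_ldagger
    by (simp only: complex_cnj_one mult_ac)
  then show ?thesis
    using assms by (simp add: sinner_def mult_single mult.commute)
qed

section \<open>The relation for single polynomials\<close>

context oriented_functional
begin

text \<open>The companion family in the other variable. Its arguments are exchanged so that
  \<open>\<psi> n m\<close> and \<open>\<phi> n m\<close> refer to the same box.\<close>

abbreviation \<psi> :: "int \<Rightarrow> int \<Rightarrow> int \<Rightarrow> laurent" where
  "\<psi> n m l \<equiv> oriented_phi L (\<sigma> \<circ> prod.swap) m n l"

text \<open>Both sides come from evaluating \<open>sinner L p q\<close>: the shift is an isometry,
  the level \<open>n\<close> terms see only the expansion of \<open>q\<close> along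
  \<open>\<psi> (n - 1) m\<close>, and the reversed terms become entries of the \<open>K1\<close>
  type.\<close>

lemma K_relation:
  assumes n: "1 \<le> n" and m: "1 \<le> m" and box: "box n m \<subseteq> B"
    and l: "l \<in> {0..m - 1}" and s: "s \<in> {0..n - 2}"
  defines "p \<equiv> Poly_Mapping.single (\<sigma> (1, 0)) 1 * \<phi> (n - 1) (m - 1) l"
    and "q \<equiv> Poly_Mapping.single (\<sigma> (1, 0)) 1 * \<psi> (n - 2) m s"
  shows "(\<Sum>t\<in>{0..m - 1}. sinner L p (\<phi> n (m - 1) t) *
      (\<Sum>u\<in>{0..n - 1}. sinner L (\<phi> n (m - 1) t) (\<psi> (n - 1) m u) *
        cnj (sinner L q (\<psi> (n - 1) m u)))) =
    sinner L (\<phi> (n - 1) (m - 1) l) (\<psi> (n - 2) m s) -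
    (\<Sum>t\<in>{0..m - 1}. sinner L p (reversal (\<sigma> (n - 1, m - 1)) (\<phi> (n - 1) (m - 1) t)) *
      cnj (sinner L (Poly_Mapping.single (\<sigma> (0, 1)) 1 * \<phi> (n - 1) (m - 1) t)
        (reversal (\<sigma> (n - 2, m)) (\<psi> (n - 2) m s))))"
proof -
  interpret swapped: oriented_functional L B "\<sigma> \<circ> prod.swap"
    by unfold_locales (use inj_\<sigma> in \<open>simp_all add: \<sigma>_add inj_compose prod.swap_def flip: \<sigma>_add\<close>)
  let ?rev = "reversal (\<sigma> (n - 1, m - 1))"
  have swapped_box: "swapped.box j i = box i j" for i j
    by (simp only: image_comp[symmetric] product_swap)
  have mono: "box i j \<subseteq> B" if "i \<le> n" "j \<le> m" for i j
    using that by (intro order.trans[OF _ box] image_mono) auto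
  have box_m: "box n (m - 1) \<subseteq> B" and box_\<psi>: "swapped.box m (n - 1) \<subseteq> B"
    and box_\<psi>': "swapped.box m (n - 2) \<subseteq> B"
    unfolding swapped_box by (simp_all add: mono)
  have m0: "0 \<le> m" and n0: "0 \<le> n" using m n by simp_all
  have keys_q: "Poly_Mapping.keys q \<subseteq> swapped.box m (n - 1)"
  proof
    fix k assume "k \<in> Poly_Mapping.keys q"
    moreover have "Poly_Mapping.keys (\<psi> (n - 2) m s) \<subseteq> box (n - 2) m"
      using swapped.keys_\<phi>_box[OF m0 box_\<psi>' s] by (simp only: swapped_box)
    ultimately obtain i j where "k = \<sigma> (1, 0) + \<sigma> (i, j)" "i \<in> {0..n - 2}" "j \<in> {0..m}"
      unfolding q_def keys_single_mult by blast
    then show "k \<in> swapped.box m (n - 1)"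
      unfolding swapped_box by (simp add: \<sigma>_shift \<sigma>_mem)
  qed
  define r where "r = q - (\<Sum>u\<in>{0..n - 1}. lscale (sinner L q (\<psi> (n - 1) m u)) (\<psi> (n - 1) m u))"
  \<comment> \<open>Dropping the top degree in the second variable leaves the box
    \<open>n - 1\<close> by \<open>m - 1\<close>, which is also the set orthogonal to
    \<open>\<phi> n (m - 1)\<close>.\<close>
  have keys_r: "Poly_Mapping.keys r \<subseteq> low n (m - 1)"
    using swapped.keys_residue_low[OF m0 box_\<psi> keys_q]
    unfolding r_def swapped.low_eq_box low_eq_box swapped_box .
  have project: "sinner L (\<phi> n (m - 1) t) q =
      (\<Sum>u\<in>{0..n - 1}. sinner L (\<phi> n (m - 1) t) (\<psi> (n - 1) m u) * cnj (sinner L q (\<psi> (n - 1) m u)))"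
    if "t \<in> {0..m - 1}" for t
    using sinner_\<phi>_low[OF n0 box_m that keys_r]
    by (simp add: r_def sinner_diff_right sinner_sum_right sinner_lscale_right mult.commute)
  have reflect: "sinner L (?rev f) q =
      cnj (sinner L (Poly_Mapping.single (\<sigma> (0, 1)) 1 * f) (reversal (\<sigma> (n - 2, m)) (\<psi> (n - 2) m s)))"
    for f
  proof -
    have "\<sigma> (1, 0) - \<sigma> (n - 1, m - 1) = \<sigma> (0, 1) - \<sigma> (n - 2, m)"
      by (simp add: \<sigma>_reflect)
    then have "sinner L q (?rev f) =
        sinner L (Poly_Mapping.single (\<sigma> (0, 1)) 1 * f) (reversal (\<sigma> (n - 2, m)) (\<psi> (n - 2) m s))"
      unfolding q_def by (rule sinner_shift_reversal)
    then show ?thesis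
      using sinner_commute[of "?rev f" q] by (simp only:)
  qed
  have "sinner L (\<phi> (n - 1) (m - 1) l) (\<psi> (n - 2) m s) = sinner L p q"
    by (simp only: p_def q_def sinner_single_mult)
  also have "p = (\<Sum>t\<in>{0..m - 1}. lscale (sinner L p (\<phi> n (m - 1) t)) (\<phi> n (m - 1) t)) +
      (\<Sum>t\<in>{0..m - 1}. lscale (sinner L p (?rev (\<phi> (n - 1) (m - 1) t))) (?rev (\<phi> (n - 1) (m - 1) t)))"
    unfolding p_def by (rule \<phi>_recurrence[OF n box_m l])
  also have "sinner L \<dots> q =
      (\<Sum>t\<in>{0..m - 1}. sinner L p (\<phi> n (m - 1) t) * sinner L (\<phi> n (m - 1) t) q) +
      (\<Sum>t\<in>{0..m - 1}. sinner L p (?rev (\<phi> (n - 1) (m - 1) t)) * sinner L (?rev (\<phi> (n - 1) (m - 1) t)) q)"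
    by (simp only: sinner_add_left sinner_sum_left sinner_lscale_left)
  also have "(\<Sum>t\<in>{0..m - 1}. sinner L p (\<phi> n (m - 1) t) * sinner L (\<phi> n (m - 1) t) q) =
      (\<Sum>t\<in>{0..m - 1}. sinner L p (\<phi> n (m - 1) t) *
        (\<Sum>u\<in>{0..n - 1}. sinner L (\<phi> n (m - 1) t) (\<psi> (n - 1) m u) *
          cnj (sinner L q (\<psi> (n - 1) m u))))"
    by (rule sum.cong) (simp_all only: project)
  finally show ?thesis
    by (simp only: reflect add_diff_cancel_right')
qed

end

section \<open>Gram matrices\<close>

text \<open>Superscripts descend from \<open>a\<close> and \<open>b\<close> to 0, matching the order
  in \<open>Phi\<close> and \<open>Phit\<close>; the value -1 gives an empty side.\<close>

definition gram ::
  "(laurent \<Rightarrow> complex) \<Rightarrow> int \<Rightarrow> int \<Rightarrow> (int \<Rightarrow> laurent) \<Rightarrow> (int \<Rightarrow> laurent) \<Rightarrow> complex mat" where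
  "gram L a b f g =
    mat (nat (a + 1)) (nat (b + 1)) (\<lambda>(r, s). sinner L (f (a - int r)) (g (b - int s)))"

lemma dim_gram [simp]:
  "dim_row (gram L a b f g) = nat (a + 1)" "dim_col (gram L a b f g) = nat (b + 1)"
  by (simp_all add: gram_def)

lemma gram_carrier: "gram L a b f g \<in> carrier_mat (nat (a + 1)) (nat (b + 1))"
  by (simp add: gram_def)

lemma index_gram [simp]:
  "r < nat (a + 1) \<Longrightarrow> s < nat (b + 1) \<Longrightarrow>
    gram L a b f g $$ (r, s) = sinner L (f (a - int r)) (g (b - int s))"
  by (simp add: gram_def)

lemma gram_cong:
  assumes "\<And>k l. k \<in> {0..a} \<Longrightarrow> l \<in> {0..b} \<Longrightarrow> sinner L (f k) (g l) = sinner L' (f' k) (g' l)"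
  shows "gram L a b f g = gram L' a b f' g'"
  by (rule eq_matI) (simp_all add: assms)

section \<open>Adjoints and inverses of complex matrices\<close>

lemma mat_adjoint_conv: "mat_adjoint A = map_mat cnj (transpose_mat A)"
  by (rule eq_matI) (simp_all add: mat_adjoint_def mat_of_rows_def conjugate_complex_def)

lemma mat_adjoint_carrier: "A \<in> carrier_mat a b \<Longrightarrow> mat_adjoint A \<in> carrier_mat b a"
  for A :: "complex mat"
  by (simp add: mat_adjoint_conv)

lemma mat_adjoint_mult:
  assumes "A \<in> carrier_mat a b" "C \<in> carrier_mat b c"
  shows "mat_adjoint (A * C) = mat_adjoint C * mat_adjoint (A :: complex mat)"
  using assms by (intro eq_matI) (auto simp: mat_adjoint_conv scalar_prod_def mult.commute)

lemma mat_adjoint_adjoint [simp]: "mat_adjoint (mat_adjoint A) = (A :: complex mat)"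
  by (rule eq_matI) (simp_all add: mat_adjoint_conv)

lemma mat_adjoint_minus:
  assumes "A \<in> carrier_mat a b" "C \<in> carrier_mat a b"
  shows "mat_adjoint (A - C) = mat_adjoint A - mat_adjoint (C :: complex mat)"
  using assms by (intro eq_matI) (auto simp: mat_adjoint_conv)

lemma sum_descending:
  "(\<Sum>t = 0..<nat (a + 1). g (a - int t)) = (\<Sum>l\<in>{0..a}. g l)" for g :: "int \<Rightarrow> complex"
  by (rule sum.reindex_bij_witness[of _ "\<lambda>l. nat (a - l)" "\<lambda>t. a - int t"]) auto

text \<open>A nonzero determinant makes \<open>A\<close> a unit, so \<open>mat_inverse A\<close> is
  not \<open>None\<close> and \<open>the\<close> returns an actual inverse.\<close>

lemma minv_inverse:
  assumes A: "A \<in> carrier_mat n n" and "det A \<noteq> 0"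
  shows "minv A \<in> carrier_mat n n" "A * minv A = 1\<^sub>m n" "minv A * A = 1\<^sub>m n"
proof -
  have "A \<in> Units (ring_mat TYPE(complex) n ())"
    using assms by (intro det_non_zero_imp_unit)
  then obtain C where "mat_inverse A = Some C"
    using mat_inverse(1)[OF A, where b = "()"] by (cases "mat_inverse A") auto
  then show "minv A \<in> carrier_mat n n" "A * minv A = 1\<^sub>m n" "minv A * A = 1\<^sub>m n"
    using mat_inverse(2)[OF A] by (simp_all add: minv_def)
qed

context definite_functional
begin

lemma mat_adjoint_gram: "mat_adjoint (gram L a b f g) = gram L b a g f"
  by (rule eq_matI) (simp_all add: mat_adjoint_conv flip: sinner_commute)

end

context oriented_functional
begin

text \<open>Because superscripts descend, vanishing for \<open>l < k\<close> is upper triangularity,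
  and the determinant is the product of the nonzero diagonal entries.\<close>

lemma det_A_nonzero:
  assumes "1 \<le> n" "box n m \<subseteq> B"
  shows "det (gram L m m (\<lambda>l. Poly_Mapping.single (\<sigma> (1, 0)) 1 * \<phi> (n - 1) m l) (\<phi> n m)) \<noteq> 0"
    (is "det ?A \<noteq> 0")
proof -
  have "upper_triangular ?A"
    unfolding upper_triangular_def using assms by (simp add: A_triangular)
  then have "det ?A = prod_list (diag_mat ?A)"
    by (rule det_upper_triangular[OF _ gram_carrier])
  also have "\<dots> \<noteq> 0"
  proof -
    have nonzero: "?A $$ (i, i) \<noteq> 0" if i: "i < nat (m + 1)" for i
    proof -
      have "m - int i \<in> {0..m}"
        using i by simp
      then show ?thesis
        unfolding index_gram[OF i i] by (rule A_diagonal[OF assms])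
    qed
    show ?thesis
    proof
      assume "prod_list (diag_mat ?A) = 0"
      then have "0 \<in> (\<lambda>i. ?A $$ (i, i)) ` {0..<nat (m + 1)}"
        unfolding prod_list_zero_iff diag_mat_def set_map set_upt dim_gram .
      then obtain i where zero: "0 = ?A $$ (i, i)" and "i \<in> {0..<nat (m + 1)}"
        by (rule imageE)
      then have "i < nat (m + 1)" by simp
      from nonzero[OF this] zero[symmetric] show False
        by (rule notE)
    qed
  qed
  finally show ?thesis .
qed

text \<open>Entry \<open>(i, j)\<close> is the scalar relation for superscripts
  \<open>m - 1 - i\<close> and \<open>n - 2 - j\<close>; for \<open>n = 1\<close> there are no
  columns.\<close>

lemma K_relation_matrix:
  assumes "1 \<le> n" "1 \<le> m" "box n m \<subseteq> B"
  shows "gram L (m - 1) (m - 1)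
      (\<lambda>l. Poly_Mapping.single (\<sigma> (1, 0)) 1 * \<phi> (n - 1) (m - 1) l) (\<phi> n (m - 1)) *
    (gram L (m - 1) (n - 1) (\<phi> n (m - 1)) (\<psi> (n - 1) m) *
     mat_adjoint (gram L (n - 2) (n - 1)
       (\<lambda>l. Poly_Mapping.single (\<sigma> (1, 0)) 1 * \<psi> (n - 2) m l) (\<psi> (n - 1) m))) =
    gram L (m - 1) (n - 2) (\<phi> (n - 1) (m - 1)) (\<psi> (n - 2) m) -
    gram L (m - 1) (m - 1) (\<lambda>l. Poly_Mapping.single (\<sigma> (1, 0)) 1 * \<phi> (n - 1) (m - 1) l)
      (\<lambda>l. reversal (\<sigma> (n - 1, m - 1)) (\<phi> (n - 1) (m - 1) l)) *
    map_mat cnj (gram L (m - 1) (n - 2)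
      (\<lambda>l. Poly_Mapping.single (\<sigma> (0, 1)) 1 * \<phi> (n - 1) (m - 1) l)
      (\<lambda>l. reversal (\<sigma> (n - 2, m)) (\<psi> (n - 2) m l)))"
    (is "?A * (?K * mat_adjoint ?G) = ?K' - ?E * map_mat cnj ?K1")
proof (rule eq_matI)
  fix i j assume "i < dim_row (?K' - ?E * map_mat cnj ?K1)" "j < dim_col (?K' - ?E * map_mat cnj ?K1)"
  then have i: "i < nat m" and j: "j < nat (n - 1)" by simp_all
  let ?p = "Poly_Mapping.single (\<sigma> (1, 0)) 1 * \<phi> (n - 1) (m - 1) (m - 1 - int i)"
  let ?q = "Poly_Mapping.single (\<sigma> (1, 0)) 1 * \<psi> (n - 2) m (n - 2 - int j)"
  have KG: "(?K * mat_adjoint ?G) $$ (t, j) =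
      (\<Sum>u\<in>{0..n - 1}. sinner L (\<phi> n (m - 1) (m - 1 - int t)) (\<psi> (n - 1) m u) *
        cnj (sinner L ?q (\<psi> (n - 1) m u)))" if "t < nat m" for t
    using that j
    by (simp add: mat_adjoint_conv scalar_prod_def flip: sum_descending)
  define Z where "Z = ?K * mat_adjoint ?G"
  have "Z \<in> carrier_mat (nat m) (nat (n - 1))"
    by (intro carrier_matI) (simp_all add: Z_def mat_adjoint_conv)
  then have "(?A * Z) $$ (i, j) = (\<Sum>t = 0..<nat m. ?A $$ (i, t) * Z $$ (t, j))"
    using i j by (simp add: scalar_prod_def)
  also have "\<dots> = (\<Sum>t\<in>{0..m - 1}. sinner L ?p (\<phi> n (m - 1) t) *
      (\<Sum>u\<in>{0..n - 1}. sinner L (\<phi> n (m - 1) t) (\<psi> (n - 1) m u) *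
        cnj (sinner L ?q (\<psi> (n - 1) m u))))"
    using i KG by (subst sum_descending[symmetric]) (simp add: Z_def)
  also have "\<dots> = sinner L (\<phi> (n - 1) (m - 1) (m - 1 - int i)) (\<psi> (n - 2) m (n - 2 - int j)) -
    (\<Sum>t\<in>{0..m - 1}. sinner L ?p (reversal (\<sigma> (n - 1, m - 1)) (\<phi> (n - 1) (m - 1) t)) *
      cnj (sinner L (Poly_Mapping.single (\<sigma> (0, 1)) 1 * \<phi> (n - 1) (m - 1) t)
        (reversal (\<sigma> (n - 2, m)) (\<psi> (n - 2) m (n - 2 - int j)))))"
    using i j by (intro K_relation[OF assms]) simp_all
  also have "\<dots> = (?K' - ?E * map_mat cnj ?K1) $$ (i, j)"
    using i j by (subst sum_descending[symmetric]) (simp add: scalar_prod_def)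
  finally show "(?A * (?K * mat_adjoint ?G)) $$ (i, j) = (?K' - ?E * map_mat cnj ?K1) $$ (i, j)"
    unfolding Z_def .
qed (simp_all add: mat_adjoint_conv)

end

section \<open>Functionals on a bounded space of Laurent polynomials\<close>

text \<open>Common shape of \<open>Phi\<close>, \<open>Phit\<close> and the transposed reversals, so
  that a single rule turns each coefficient matrix into a \<open>gram\<close> matrix.\<close>

definition descending_col :: "int \<Rightarrow> (int \<Rightarrow> laurent) \<Rightarrow> laurent mat" where
  "descending_col a f = mat (nat (a + 1)) 1 (\<lambda>(r, _). f (a - int r))"

lemma Phi_eq_col: "Phi L n m = descending_col m (\<lambda>l. phi L l n m)"
  by (simp add: Phi_def descending_col_def)

lemma Phit_eq_col: "Phit L n m = descending_col n (\<lambda>l. phit L l n m)"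
  by (simp add: Phit_def descending_col_def)

lemma smult_descending_col: "c \<cdot>\<^sub>m descending_col a f = descending_col a (\<lambda>l. c * f l)"
  by (rule eq_matI) (simp_all add: descending_col_def)

lemma transpose_rev_Phi:
  "transpose_mat (rev_Phi L n m) = descending_col m (\<lambda>l. reversal (n, m) (phi L l n m))"
  by (rule eq_matI)
    (simp_all add: rev_Phi_def Phi_eq_col descending_col_def mdagger_def reversal_def zw_monom_def)

lemma transpose_rev_Phit:
  "transpose_mat (rev_Phit L n m) = descending_col n (\<lambda>l. reversal (n, m) (phit L l n m))"
  by (rule eq_matI)
    (simp_all add: rev_Phit_def Phit_eq_col descending_col_def mdagger_def reversal_def zw_monom_def)

lemma minner_descending_col: "minner L (descending_col a f) (descending_col b g) = gram L a b f g"
  by (rule eq_matI)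
    (simp_all add: minner_def descending_col_def mdagger_def scalar_prod_def sinner_def)

text \<open>Agrees with \<open>L\<close> on the relevant space but is linear and Hermitian on all Laurent polynomials,
  so that the sesquilinear form needs no membership conditions.\<close>

definition truncated :: "(laurent \<Rightarrow> complex) \<Rightarrow> int \<Rightarrow> int \<Rightarrow> laurent \<Rightarrow> complex" where
  "truncated L N M p = (\<Sum>k\<in>{- N..N} \<times> {- M..M}. Poly_Mapping.lookup p k * L (Poly_Mapping.single k 1))"

lemma Pi_space_eq: "Pi_space N M = {p. Poly_Mapping.keys p \<subseteq> {- N..N} \<times> {- M..M}}"
proof -
  have "\<bar>i\<bar> \<le> N \<and> \<bar>j\<bar> \<le> M \<longleftrightarrow> (i, j) \<in> {- N..N} \<times> {- M..M}" for i j
    by auto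
  then show ?thesis
    by (simp only: Pi_space_def span_zw_monom)
qed

lemma Pi_hat_eq: "Pi_hat N M = {p. Poly_Mapping.keys p \<subseteq> {0..N} \<times> {0..M}}"
proof -
  have "0 \<le> i \<and> i \<le> N \<and> 0 \<le> j \<and> j \<le> M \<longleftrightarrow> (i, j) \<in> {0..N} \<times> {0..M}" for i j
    by auto
  then show ?thesis
    by (simp only: Pi_hat_def span_zw_monom)
qed

lemma truncated_eq:
  assumes lin: "linear_functional_on (Pi_space N M) L" and p: "p \<in> Pi_space N M"
  shows "truncated L N M p = L p"
proof -
  \<comment> \<open>The value at 0 follows from homogeneity on \<open>Pi_space N M\<close>, which
    contains 0.\<close>
  have "L (lscale 0 0) = 0 * L 0"
    using lin laurent.span_zero unfolding linear_functional_on_def Pi_space_def by blast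
  then have zero: "L 0 = 0"
    by simp
  have sub: "laurent.subspace (Pi_space N M)"
    by (simp add: Pi_space_def)
  have sum: "L (\<Sum>k\<in>K. lscale (c k) (Poly_Mapping.single k 1)) =
      (\<Sum>k\<in>K. c k * L (Poly_Mapping.single k 1))"
    if "finite K" "K \<subseteq> {- N..N} \<times> {- M..M}" for K c
    using that
  proof (induction K rule: finite_induct)
    case (insert x K)
    have x: "Poly_Mapping.single x 1 \<in> Pi_space N M"
      using insert.prems by (simp add: Pi_space_eq)
    have "Poly_Mapping.keys (\<Sum>k\<in>K. lscale (c k) (Poly_Mapping.single k 1)) \<subseteq> {- N..N} \<times> {- M..M}"
    proof (intro keys_sum_subset order.trans[OF keys_lscale_subset])
      fix k assume "k \<in> K"
      then show "Poly_Mapping.keys (Poly_Mapping.single k (1::complex)) \<subseteq> {- N..N} \<times> {- M..M}"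
        using insert.prems by auto
    qed
    then have "(\<Sum>k\<in>K. lscale (c k) (Poly_Mapping.single k 1)) \<in> Pi_space N M"
      by (simp add: Pi_space_eq)
    then show ?case
      using lin insert x laurent.subspace_scale[OF sub x]
      by (simp add: linear_functional_on_def)
  qed (simp add: zero)
  have keys: "Poly_Mapping.keys p \<subseteq> {- N..N} \<times> {- M..M}"
    using p by (simp add: Pi_space_eq)
  have "truncated L N M p = (\<Sum>k\<in>Poly_Mapping.keys p. Poly_Mapping.lookup p k * L (Poly_Mapping.single k 1))"
    unfolding truncated_def using keys
    by (intro sum.mono_neutral_right) (simp_all add: in_keys_iff)
  also have "\<dots> = L p"
    using sum[OF _ keys, of "Poly_Mapping.lookup p"] by (simp add: lscale_single sum_single_lookup)
  finally show ?thesis .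
qed

text \<open>Differences of exponents from the nonnegative box lie in the symmetric box, where the
  functional is controlled.\<close>

lemma mult_ldagger_in_Pi_space:
  assumes "Poly_Mapping.keys p \<subseteq> {0..N} \<times> {0..M}" "Poly_Mapping.keys q \<subseteq> {0..N} \<times> {0..M}"
  shows "p * ldagger q \<in> Pi_space N M"
  unfolding Pi_space_eq mem_Collect_eq
proof
  fix k assume "k \<in> Poly_Mapping.keys (p * ldagger q)"
  then have "k \<in> {a + b |a b. a \<in> Poly_Mapping.keys p \<and> b \<in> uminus ` Poly_Mapping.keys q}"
    using subsetD[OF keys_mult[of p "ldagger q"]] unfolding keys_ldagger by blast
  then obtain a b where k: "k = a + - b" "a \<in> Poly_Mapping.keys p" "b \<in> Poly_Mapping.keys q"
    by blast
  obtain i j i' j' where ab: "a = (i, j)" "b = (i', j')"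
    by (cases a, cases b)
  have "a \<in> {0..N} \<times> {0..M}" "b \<in> {0..N} \<times> {0..M}"
    using k assms by blast+
  then show "k \<in> {- N..N} \<times> {- M..M}"
    by (simp add: k(1) ab)
qed

lemma sinner_truncated:
  assumes "linear_functional_on (Pi_space N M) L"
    and "Poly_Mapping.keys p \<subseteq> {0..N} \<times> {0..M}" "Poly_Mapping.keys q \<subseteq> {0..N} \<times> {0..M}"
  shows "sinner (truncated L N M) p q = sinner L p q"
  unfolding sinner_def by (intro truncated_eq mult_ldagger_in_Pi_space assms)

text \<open>Hermitian symmetry comes from reindexing the symmetric box by negation; definiteness is
  inherited since both forms agree on the nonnegative box.\<close>

lemma definite_functional_truncated:
  assumes "pos_def_functional N M L"
  shows "definite_functional (truncated L N M) ({0..N} \<times> {0..M})"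
proof
  have lin: "linear_functional_on (Pi_space N M) L"
    and herm': "\<And>i j. \<bar>i\<bar> \<le> N \<Longrightarrow> \<bar>j\<bar> \<le> M \<Longrightarrow> L (zw_monom (- i) (- j)) = cnj (L (zw_monom i j))"
    and pos: "\<And>p. p \<in> Pi_hat N M \<Longrightarrow> p \<noteq> 0 \<Longrightarrow> positive_real (sinner L p p)"
    using assms unfolding pos_def_functional_def sinner_def by blast+
  have herm: "L (Poly_Mapping.single (- k) 1) = cnj (L (Poly_Mapping.single k 1))"
    if "k \<in> {- N..N} \<times> {- M..M}" for k
  proof (cases k)
    case (Pair i j)
    then have "\<bar>i\<bar> \<le> N" "\<bar>j\<bar> \<le> M"
      using that by auto
    from herm'[OF this] show ?thesis
      by (simp add: Pair zw_monom_def)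
  qed
  fix p q c
  show "truncated L N M (p + q) = truncated L N M p + truncated L N M q"
    by (simp add: truncated_def lookup_add distrib_right sum.distrib)
  show "truncated L N M (lscale c p) = c * truncated L N M p"
    by (simp add: truncated_def sum_distrib_left mult.assoc)
  have "truncated L N M (ldagger p) =
      (\<Sum>k\<in>{- N..N} \<times> {- M..M}. Poly_Mapping.lookup (ldagger p) (- k) * L (Poly_Mapping.single (- k) 1))"
    unfolding truncated_def by (rule sum.reindex_bij_witness[of _ uminus uminus]) (simp_all add: mem_Times_iff)
  also have "\<dots> = cnj (truncated L N M p)"
    unfolding truncated_def cnj_sum by (intro sum.cong) (simp_all only: herm lookup_ldagger minus_minus complex_cnj_mult)
  finally show "truncated L N M (ldagger p) = cnj (truncated L N M p)" .
  assume p: "Poly_Mapping.keys p \<subseteq> {0..N} \<times> {0..M}" "p \<noteq> 0"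
  then show "positive_real (sinner (truncated L N M) p p)"
    using pos[of p] by (simp add: sinner_truncated[OF lin] Pi_hat_eq)
qed

text \<open>Every inner product in the predicate involves polynomials supported in \<open>S\<close>,
  so the polynomials selected by \<open>THE\<close> coincide.\<close>

lemma orthonormal_for_truncated:
  assumes "linear_functional_on (Pi_space N M) L" and S: "S \<subseteq> {0..N} \<times> {0..M}"
  shows "orthonormal_for (truncated L N M) S k = orthonormal_for L S k"
proof
  fix p
  have "sinner (truncated L N M) p q = sinner L p q"
    if "Poly_Mapping.keys p \<subseteq> S" "Poly_Mapping.keys q \<subseteq> S" for q
    using that S by (intro sinner_truncated assms(1)) (meson order.trans)+
  then show "orthonormal_for (truncated L N M) S k p = orthonormal_for L S k p"
    unfolding orthonormal_for_iff by (auto simp del: split_paired_All split_paired_all)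
qed

lemma phi_eq_oriented:
  assumes "linear_functional_on (Pi_space N M) L"
    and "0 \<le> n" "n \<le> N" "m \<le> M" "l \<in> {0..m}"
  shows "phi L l n m = oriented_phi (truncated L N M) id n m l"
proof -
  have "{0..<n} \<times> {0..m} \<union> {n} \<times> {0..l} \<subseteq> {0..N} \<times> {0..M}"
    using assms by auto
  then show ?thesis
    unfolding phi_def oriented_phi_def by (simp add: orthonormal_for_truncated[OF assms(1)])
qed

lemma phit_eq_oriented:
  assumes "linear_functional_on (Pi_space N M) L"
    and "0 \<le> m" "n \<le> N" "m \<le> M" "l \<in> {0..n}"
  shows "phit L l n m = oriented_phi (truncated L N M) prod.swap m n l"
proof -
  have "{0..n} \<times> {0..<m} \<union> {0..l} \<times> {m} \<subseteq> {0..N} \<times> {0..M}"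
    using assms by auto
  then show ?thesis
    unfolding phit_def oriented_phi_def
    by (simp add: orthonormal_for_truncated[OF assms(1)] image_Un product_swap)
qed

section \<open>Coefficient matrices as Gram matrices of the truncated functional\<close>

locale truncated_setting =
  fixes L :: "laurent \<Rightarrow> complex" and N M :: int
  assumes pos_def: "pos_def_functional N M L"
begin

abbreviation H :: "laurent \<Rightarrow> complex" where "H \<equiv> truncated L N M"
abbreviation \<phi>z :: "int \<Rightarrow> int \<Rightarrow> int \<Rightarrow> laurent" where "\<phi>z n m \<equiv> oriented_phi H id n m"
abbreviation \<phi>w :: "int \<Rightarrow> int \<Rightarrow> int \<Rightarrow> laurent" where "\<phi>w n m \<equiv> oriented_phi H prod.swap m n"
abbreviation Z :: laurent where "Z \<equiv> Poly_Mapping.single (1, 0) 1"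
abbreviation W :: laurent where "W \<equiv> Poly_Mapping.single (0, 1) 1"

lemma linear: "linear_functional_on (Pi_space N M) L"
  using pos_def unfolding pos_def_functional_def by blast

sublocale definite_functional H "{0..N} \<times> {0..M}"
  by (rule definite_functional_truncated[OF pos_def])

sublocale z: oriented_functional H "{0..N} \<times> {0..M}" id
  by unfold_locales simp_all

sublocale w: oriented_functional H "{0..N} \<times> {0..M}" prod.swap
  by unfold_locales (simp_all add: prod.swap_def)

definition in_box :: "int \<Rightarrow> int \<Rightarrow> laurent \<Rightarrow> bool" where
  "in_box n m p \<longleftrightarrow> Poly_Mapping.keys p \<subseteq> {0..n} \<times> {0..m}"

lemma in_box_\<phi>z:
  assumes "0 \<le> n" "n \<le> N" "m \<le> M" "l \<in> {0..m}"
  shows "in_box n m (\<phi>z n m l)"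
  using z.keys_\<phi>_box[of n m l] assms by (simp add: in_box_def Sigma_mono)

lemma in_box_\<phi>w:
  assumes "0 \<le> m" "n \<le> N" "m \<le> M" "l \<in> {0..n}"
  shows "in_box n m (\<phi>w n m l)"
  using w.keys_\<phi>_box[of m n l] assms by (simp add: in_box_def Sigma_mono product_swap)

lemma in_box_Z_mult:
  assumes "in_box (n - 1) m p"
  shows "in_box n m (Z * p)"
  unfolding in_box_def
proof
  fix k assume "k \<in> Poly_Mapping.keys (Z * p)"
  then obtain i j where "k = (1, 0) + (i, j)" "i \<in> {0..n - 1}" "j \<in> {0..m}"
    using assms unfolding in_box_def keys_single_mult by blast
  then show "k \<in> {0..n} \<times> {0..m}" by simp
qed

lemma in_box_W_mult:
  assumes "in_box n (m - 1) p"
  shows "in_box n m (W * p)"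
  unfolding in_box_def
proof
  fix k assume "k \<in> Poly_Mapping.keys (W * p)"
  then obtain i j where "k = (0, 1) + (i, j)" "i \<in> {0..n}" "j \<in> {0..m - 1}"
    using assms unfolding in_box_def keys_single_mult by blast
  then show "k \<in> {0..n} \<times> {0..m}" by simp
qed

lemma in_box_reversal: "in_box n m p \<Longrightarrow> in_box n m (reversal (n, m) p)"
  using z.keys_reversal_box[of p n m] by (simp add: in_box_def)

text \<open>Exchanges the functional and both families at once. Rows and columns carry separate
  degree bounds because shifts and reversals change them differently.\<close>

lemma gram_truncated:
  assumes "\<And>k. k \<in> {0..a} \<Longrightarrow> f k = f' k" "\<And>l. l \<in> {0..b} \<Longrightarrow> g l = g' l"
    and "\<And>k. k \<in> {0..a} \<Longrightarrow> in_box n m (f' k)" "\<And>l. l \<in> {0..b} \<Longrightarrow> in_box n' m' (g' l)"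
    and "n \<le> N" "m \<le> M" "n' \<le> N" "m' \<le> M"
  shows "gram L a b f g = gram H a b f' g'"
proof (rule gram_cong)
  fix k l assume kl: "k \<in> {0..a}" "l \<in> {0..b}"
  have "{0..n} \<times> {0..m} \<subseteq> {0..N} \<times> {0..M}" "{0..n'} \<times> {0..m'} \<subseteq> {0..N} \<times> {0..M}"
    using assms(5-) by (simp_all add: Sigma_mono)
  then have "Poly_Mapping.keys (f' k) \<subseteq> {0..N} \<times> {0..M}" "Poly_Mapping.keys (g' l) \<subseteq> {0..N} \<times> {0..M}"
    using assms(3)[OF kl(1)] assms(4)[OF kl(2)] unfolding in_box_def by (meson order.trans)+
  from sinner_truncated[OF linear this]
  show "sinner L (f k) (g l) = sinner H (f' k) (g' l)"
    by (simp only: assms(1)[OF kl(1)] assms(2)[OF kl(2)])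
qed

lemmas col_simps = Phi_eq_col Phit_eq_col transpose_rev_Phi transpose_rev_Phit
  smult_descending_col minner_descending_col zw_monom_def

lemma A_coeff_eq:
  assumes "1 \<le> n" "n \<le> N" "0 \<le> m" "m \<le> M"
  shows "A_coeff L n m = gram H m m (\<lambda>l. Z * \<phi>z (n - 1) m l) (\<phi>z n m)"
  unfolding A_coeff_def col_simps
  by (rule gram_truncated[where n = n and m = m and n' = n and m' = m])
    (use assms in \<open>simp_all add: phi_eq_oriented[OF linear] in_box_Z_mult in_box_\<phi>z\<close>)

lemma At_coeff_eq:
  assumes "1 \<le> m" "n \<le> N" "0 \<le> n" "m \<le> M"
  shows "At_coeff L n m = gram H n n (\<lambda>l. W * \<phi>w n (m - 1) l) (\<phi>w n m)"
  unfolding At_coeff_def col_simps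
  by (rule gram_truncated[where n = n and m = m and n' = n and m' = m])
    (use assms in \<open>simp_all add: phit_eq_oriented[OF linear] in_box_W_mult in_box_\<phi>w\<close>)

lemma E_hat_eq:
  assumes "1 \<le> n" "n \<le> N" "0 \<le> m" "m \<le> M"
  shows "E_hat L n m =
    gram H m m (\<lambda>l. Z * \<phi>z (n - 1) m l) (\<lambda>l. reversal (n - 1, m) (\<phi>z (n - 1) m l))"
  unfolding E_hat_def col_simps
  by (rule gram_truncated[where n = n and m = m and n' = "n - 1" and m' = m])
    (use assms in \<open>simp_all add: phi_eq_oriented[OF linear] in_box_Z_mult in_box_\<phi>z in_box_reversal\<close>)

lemma Et_hat_eq:
  assumes "1 \<le> m" "n \<le> N" "0 \<le> n" "m \<le> M"
  shows "Et_hat L n m =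
    gram H n n (\<lambda>l. W * \<phi>w n (m - 1) l) (\<lambda>l. reversal (n, m - 1) (\<phi>w n (m - 1) l))"
  unfolding Et_hat_def col_simps
  by (rule gram_truncated[where n = n and m = m and n' = n and m' = "m - 1"])
    (use assms in \<open>simp_all add: phit_eq_oriented[OF linear] in_box_W_mult in_box_\<phi>w in_box_reversal\<close>)

text \<open>The case \<open>n = 0\<close> is needed for \<open>K_coeff L (n - 1) m\<close> at
  \<open>n = 1\<close>; then the tilde family is empty and its conditions are vacuous.\<close>

lemma K_coeff_eq:
  assumes "0 \<le> n" "n \<le> N" "0 \<le> m" "m \<le> M"
  shows "K_coeff L n m = gram H (m - 1) (n - 1) (\<phi>z n (m - 1)) (\<phi>w (n - 1) m)"
  unfolding K_coeff_def col_simps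
  by (rule gram_truncated[where n = n and m = "m - 1" and n' = "n - 1" and m' = m])
    (use assms in \<open>simp_all add: phi_eq_oriented[OF linear] phit_eq_oriented[OF linear] in_box_\<phi>z in_box_\<phi>w\<close>)

lemma K1_coeff_eq:
  assumes "0 \<le> n" "n \<le> N" "0 \<le> m" "m \<le> M"
  shows "K1_coeff L n m =
    gram H (m - 1) (n - 1) (\<lambda>l. W * \<phi>z n (m - 1) l) (\<lambda>l. reversal (n - 1, m) (\<phi>w (n - 1) m l))"
  unfolding K1_coeff_def col_simps
  by (rule gram_truncated[where n = n and m = m and n' = "n - 1" and m' = m])
    (use assms in \<open>simp_all add: phi_eq_oriented[OF linear] phit_eq_oriented[OF linear]
      in_box_W_mult in_box_\<phi>z in_box_\<phi>w in_box_reversal\<close>)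

lemma Gamma1_eq:
  assumes "0 \<le> n" "n \<le> N" "0 \<le> m" "m \<le> M"
  shows "Gamma1 L n m = gram H (m - 1) m (\<lambda>l. W * \<phi>z n (m - 1) l) (\<phi>z n m)"
  unfolding Gamma1_def col_simps
  by (rule gram_truncated[where n = n and m = m and n' = n and m' = m])
    (use assms in \<open>simp_all add: phi_eq_oriented[OF linear] in_box_W_mult in_box_\<phi>z\<close>)

lemma Gammat1_eq:
  assumes "0 \<le> n" "n \<le> N" "0 \<le> m" "m \<le> M"
  shows "Gammat1 L n m = gram H (n - 1) n (\<lambda>l. Z * \<phi>w (n - 1) m l) (\<phi>w n m)"
  unfolding Gammat1_def col_simps
  by (rule gram_truncated[where n = n and m = m and n' = n and m' = m])
    (use assms in \<open>simp_all add: phit_eq_oriented[OF linear] in_box_Z_mult in_box_\<phi>w\<close>)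

section \<open>Both relations before division by the triangular factors\<close>

context
  fixes n m :: int
  assumes nm: "0 < n" "n \<le> N" "0 < m" "m \<le> M"
begin

lemma K_relation_z:
  "A_coeff L n (m - 1) * (K_coeff L n m * mat_adjoint (Gammat1 L (n - 1) m)) =
    K_coeff L (n - 1) m - E_hat L n (m - 1) * map_mat cnj (K1_coeff L (n - 1) m)"
  using z.K_relation_matrix[of n m] nm
  by (simp add: A_coeff_eq K_coeff_eq Gammat1_eq E_hat_eq K1_coeff_eq Sigma_mono)

text \<open>The matrix relation for the swapped orientation. There the two families trade roles, so
  the matrices \<open>K\<close> and \<open>Gamma1\<close> enter through their adjoints.\<close>

lemma K_relation_w:
  "At_coeff L (n - 1) m * (mat_adjoint (K_coeff L n m) * mat_adjoint (Gamma1 L n (m - 1))) =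
    mat_adjoint (K_coeff L n (m - 1)) - Et_hat L (n - 1) m * mat_adjoint (K1_coeff L n (m - 1))"
proof -
  \<comment> \<open>\<open>sinner_shift_reversal\<close> exchanges the two families and thereby
    transposes the matrix, so only the conjugation of the adjoint remains. Both exponent differences
    equal \<open>(1 - n, 2 - m)\<close>.\<close>
  have K1: "mat_adjoint (K1_coeff L n (m - 1)) =
      map_mat cnj (gram H (n - 1) (m - 2) (\<lambda>l. Z * \<phi>w (n - 1) (m - 1) l)
        (\<lambda>l. reversal (n, m - 2) (\<phi>z n (m - 2) l)))"
  proof (rule eq_matI)
    fix i j
    assume "i < dim_row (map_mat cnj (gram H (n - 1) (m - 2) (\<lambda>l. Z * \<phi>w (n - 1) (m - 1) l)
        (\<lambda>l. reversal (n, m - 2) (\<phi>z n (m - 2) l))))"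
      "j < dim_col (map_mat cnj (gram H (n - 1) (m - 2) (\<lambda>l. Z * \<phi>w (n - 1) (m - 1) l)
        (\<lambda>l. reversal (n, m - 2) (\<phi>z n (m - 2) l))))"
    then show "mat_adjoint (K1_coeff L n (m - 1)) $$ (i, j) =
      map_mat cnj (gram H (n - 1) (m - 2) (\<lambda>l. Z * \<phi>w (n - 1) (m - 1) l)
        (\<lambda>l. reversal (n, m - 2) (\<phi>z n (m - 2) l))) $$ (i, j)"
      using nm by (simp add: K1_coeff_eq mat_adjoint_conv
        sinner_shift_reversal[where a = "(0, 1)" and b = "(n - 1, m - 1)" and a' = "(1, 0)" and b' = "(n, m - 2)"])
  qed (use nm in \<open>simp_all add: K1_coeff_eq mat_adjoint_conv\<close>)
  have swap: "prod.swap \<circ> prod.swap = (id :: int \<times> int \<Rightarrow> int \<times> int)"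
    by auto
  show ?thesis
    using w.K_relation_matrix[of m n] nm unfolding K1
    by (simp add: At_coeff_eq K_coeff_eq Gamma1_eq Et_hat_eq mat_adjoint_gram swap product_swap Sigma_mono)
qed

lemma det_A_coeff: "det (A_coeff L n (m - 1)) \<noteq> 0"
  using z.det_A_nonzero[of n "m - 1"] nm by (simp add: A_coeff_eq Sigma_mono)

lemma det_At_coeff: "det (At_coeff L (n - 1) m) \<noteq> 0"
  using w.det_A_nonzero[of m "n - 1"] nm by (simp add: At_coeff_eq Sigma_mono product_swap)

end

end

lemma minv_left_divide:
  assumes "A \<in> carrier_mat a a" "det A \<noteq> 0" "X \<in> carrier_mat a b" "A * X = Y"
  shows "X = minv A * Y"
proof -
  have "minv A * Y = (minv A * A) * X"
    using assms minv_inverse[OF assms(1,2)] by (metis assoc_mult_mat)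
  then show ?thesis
    using assms minv_inverse[OF assms(1,2)] by simp
qed

theorem lemma3p11:
  fixes L :: "laurent \<Rightarrow> complex" and N M n m :: int
  assumes "pos_def_functional N M L"
    and "0 < n" and "n \<le> N" and "0 < m" and "m \<le> M"
  shows "Gamma1 L n (m - 1) * K_coeff L n m =
           K_coeff L n (m - 1) * mat_adjoint (minv (At_coeff L (n - 1) m))
           - K1_coeff L n (m - 1) * mat_adjoint (Et_hat L (n - 1) m)
               * mat_adjoint (minv (At_coeff L (n - 1) m))
       \<and> K_coeff L n m * mat_adjoint (Gammat1 L (n - 1) m) =
           minv (A_coeff L n (m - 1)) * K_coeff L (n - 1) m
           - minv (A_coeff L n (m - 1)) * E_hat L n (m - 1)
               * map_mat cnj (K1_coeff L (n - 1) m)"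
proof -
  interpret truncated_setting L N M
    by unfold_locales (rule assms(1))
  note nm = assms(2-5)
  define a b where "a = nat n" and "b = nat m"
  have A: "A_coeff L n (m - 1) \<in> carrier_mat b b"
    and At: "At_coeff L (n - 1) m \<in> carrier_mat a a"
    and E: "E_hat L n (m - 1) \<in> carrier_mat b b"
    and Et: "Et_hat L (n - 1) m \<in> carrier_mat a a"
    and K: "K_coeff L n m \<in> carrier_mat b a"
    and Kz: "K_coeff L (n - 1) m \<in> carrier_mat b (nat (n - 1))"
    and Kw: "K_coeff L n (m - 1) \<in> carrier_mat (nat (m - 1)) a"
    and K1z: "map_mat cnj (K1_coeff L (n - 1) m) \<in> carrier_mat b (nat (n - 1))"
    and K1w: "K1_coeff L n (m - 1) \<in> carrier_mat (nat (m - 1)) a"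
    and G: "Gamma1 L n (m - 1) \<in> carrier_mat (nat (m - 1)) b"
    and Gt: "Gammat1 L (n - 1) m \<in> carrier_mat (nat (n - 1)) a"
    using nm by (auto simp: A_coeff_eq At_coeff_eq E_hat_eq Et_hat_eq K_coeff_eq K1_coeff_eq
        Gamma1_eq Gammat1_eq a_def b_def intro!: carrier_matI)
  note adj = mat_adjoint_carrier
  note minvA = minv_inverse[OF A det_A_coeff[OF nm]]
  note minvAt = minv_inverse[OF At det_At_coeff[OF nm]]
  have "K_coeff L n m * mat_adjoint (Gammat1 L (n - 1) m) =
      minv (A_coeff L n (m - 1)) *
        (K_coeff L (n - 1) m - E_hat L n (m - 1) * map_mat cnj (K1_coeff L (n - 1) m))"
    by (rule minv_left_divide[OF A det_A_coeff[OF nm] _ K_relation_z[OF nm]])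
      (rule mult_carrier_mat[OF K adj[OF Gt]])
  also have "\<dots> = minv (A_coeff L n (m - 1)) * K_coeff L (n - 1) m
      - minv (A_coeff L n (m - 1)) * E_hat L n (m - 1) * map_mat cnj (K1_coeff L (n - 1) m)"
    by (simp only: mult_minus_distrib_mat[OF minvA(1) Kz mult_carrier_mat[OF E K1z]]
        assoc_mult_mat[OF minvA(1) E K1z])
  finally have second: "K_coeff L n m * mat_adjoint (Gammat1 L (n - 1) m) = \<dots>" .
  \<comment> \<open>The first identity is derived in adjoint form, where the inverse stands on the
    left as in the second.\<close>
  have "mat_adjoint (Gamma1 L n (m - 1) * K_coeff L n m) =
      mat_adjoint (K_coeff L n m) * mat_adjoint (Gamma1 L n (m - 1))"
    by (rule mat_adjoint_mult[OF G K])
  also have "\<dots> = minv (At_coeff L (n - 1) m) * (mat_adjoint (K_coeff L n (m - 1))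
        - Et_hat L (n - 1) m * mat_adjoint (K1_coeff L n (m - 1)))"
    by (rule minv_left_divide[OF At det_At_coeff[OF nm] _ K_relation_w[OF nm]])
      (rule mult_carrier_mat[OF adj[OF K] adj[OF G]])
  also have "\<dots> = minv (At_coeff L (n - 1) m) * mat_adjoint (K_coeff L n (m - 1))
      - minv (At_coeff L (n - 1) m) * (Et_hat L (n - 1) m * mat_adjoint (K1_coeff L n (m - 1)))"
    by (rule mult_minus_distrib_mat[OF minvAt(1) adj[OF Kw] mult_carrier_mat[OF Et adj[OF K1w]]])
  \<comment> \<open>The adjoint of the whole chain is taken: products reverse, the inverse moves to
    the right, and a double adjoint remains on the left side.\<close>
  also have "mat_adjoint \<dots> = K_coeff L n (m - 1) * mat_adjoint (minv (At_coeff L (n - 1) m))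
      - K1_coeff L n (m - 1) * mat_adjoint (Et_hat L (n - 1) m)
          * mat_adjoint (minv (At_coeff L (n - 1) m))"
    by (simp only: mat_adjoint_adjoint
        mat_adjoint_minus[OF mult_carrier_mat[OF minvAt(1) adj[OF Kw]]
          mult_carrier_mat[OF minvAt(1) mult_carrier_mat[OF Et adj[OF K1w]]]]
        mat_adjoint_mult[OF minvAt(1) adj[OF Kw]]
        mat_adjoint_mult[OF minvAt(1) mult_carrier_mat[OF Et adj[OF K1w]]]
        mat_adjoint_mult[OF Et adj[OF K1w]])
  finally show ?thesis
    using second by (simp only: mat_adjoint_adjoint)
qed

end
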